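(* Let $N\ge 1$, $0<\alpha<1$, $\rho\ge 0$, $\sigma>-1$, $p>1$, and $u_0\ge 0$ on $\mathbb{R}^N$. If $$1<p\le p_c=1+\frac{2(\sigma+1)+\rho\alpha}{N\alpha},$$ then the problem $$u_t(x,t)=\Delta_x D_{0+,t}^{1-\alpha}u(x,t)+t^\sigma|x|^\rho u^p(x,t),\quad x\in\mathbb{R}^N,\ t>0,\qquad u(x,0)=u_0(x)\ge 0,$$ admits no global weak nonnegative solutions other than the trivial one $u=0$.
   Context: $D_{0+,t}^{1-\alpha}g(t)=\frac{1}{\Gamma(\alpha)}\frac{d}{dt}\int_0^t (t-s)^{\alpha-1}g(s)\,ds$ is the left Riemann-Liouville derivative, and $\mathcal{D}_{T-,t}^{1-\alpha}g(t)=-\frac{1}{\Gamma(\alpha)}\int_t^T (s-t)^{\alpha-1}g'(s)\,ds$ is the right Caputo derivative of order $1-\alpha$. Let $\Omega_T=\mathbb{R}^N\times(0,T)$ and $\Omega_\infty=\mathbb{R}^N\times(0,\infty)$. A function $u\in L^1_{loc}(\Omega_\infty)$ is a global weak solution of the problem if $$-\int_{\mathbb{R}^N}u_0(x)\varphi(x,0)\,dx-\int_{\Omega_\infty}|x|^\rho t^\sigma u^p(x,t)\varphi(x,t)\,dx\,dt=\int_{\Omega_\infty}u(x,t)\,\mathcal{D}_{T-,t}^{1-\alpha}\Delta_x\varphi(x,t)\,dx\,dt+\int_{\Omega_\infty}u(x,t)\varphi_t(x,t)\,dx\,dt$$ for every $T>0$ and every test function $\varphi\in C^{2,1}_{x,t}(\Omega_T)$,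 compactly supported in $x$ and such that the integrals are meaningful, with $\varphi(x,T)=0$; here $\varphi$ and the terms $\varphi_t$, $\mathcal{D}_{T-,t}^{1-\alpha}\Delta_x\varphi$ are taken to be zero for $t>T$. *)

theory Defs
  imports "HOL-Analysis.Analysis"
begin

definition Omega :: "real \<Rightarrow> ((real^'n) \<times> real) set" where
  "Omega T = UNIV \<times> {0<..<T}"

definition Omega_inf :: "((real^'n) \<times> real) set" where
  "Omega_inf = UNIV \<times> {0<..}"

definition partial_x :: "'n \<Rightarrow> (real^'n \<Rightarrow> real) \<Rightarrow> real^'n \<Rightarrow> real" where
  "partial_x i f x = deriv (\<lambda>h. f (x + h *\<^sub>R axis i 1)) 0"

definition has_partial_x :: "'n \<Rightarrow> (real^'n \<Rightarrow> real) \<Rightarrow> real^'n \<Rightarrow> bool" where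
  "has_partial_x i f x \<longleftrightarrow> (\<lambda>h. f (x + h *\<^sub>R axis i 1)) differentiable (at 0)"

definition laplacian :: "(real^'n \<Rightarrow> real) \<Rightarrow> real^'n \<Rightarrow> real" where
  "laplacian f x = (\<Sum>i\<in>UNIV. partial_x i (partial_x i f) x)"

text \<open>The right Caputo derivative of order \<^term>\<open>1 - \<alpha>\<close> with terminal time \<^term>\<open>T\<close>.\<close>

definition caputo_right :: "real \<Rightarrow> real \<Rightarrow> (real \<Rightarrow> real) \<Rightarrow> real \<Rightarrow> real" where
  "caputo_right \<alpha> T g t =
     - (1 / Gamma \<alpha>) * (LINT s:{t<..<T}|lebesgue. (s - t) powr (\<alpha> - 1) * deriv g s)"

text \<open>Continuous differentiability in time on the closed slab, with one-sided derivatives at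
  \<^term>\<open>0\<close> and \<^term>\<open>T\<close>. On the open interval the derivative below is the ordinary one.\<close>

definition C1_time :: "real \<Rightarrow> (real^'n \<Rightarrow> real \<Rightarrow> real) \<Rightarrow> bool" where
  "C1_time T f \<longleftrightarrow>
     (\<forall>x. \<forall>t\<in>{0..T}. f x differentiable (at t within {0..T})) \<and>
     continuous_on (UNIV \<times> {0..T}) (\<lambda>(x, t). vector_derivative (f x) (at t within {0..T}))"

text \<open>\<open>C\<^sup>2\<^sup>,\<^sup>1\<close> in \<open>(x, t)\<close>, up to the boundary times \<open>0\<close> and \<open>T\<close>:
  \<open>\<phi>\<close>, its spatial derivatives of orders one and two and its first time derivative exist and are
  jointly continuous.\<close>

definition C21 :: "real \<Rightarrow> (real^'n \<Rightarrow> real \<Rightarrow> real) \<Rightarrow> bool" where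
  "C21 T \<phi> \<longleftrightarrow>
     continuous_on (UNIV \<times> {0..T}) (\<lambda>(x, t). \<phi> x t) \<and>
     (\<forall>i. (\<forall>x. \<forall>t\<in>{0..T}. has_partial_x i (\<lambda>y. \<phi> y t) x) \<and>
          continuous_on (UNIV \<times> {0..T}) (\<lambda>(x, t). partial_x i (\<lambda>y. \<phi> y t) x)) \<and>
     (\<forall>i j. (\<forall>x. \<forall>t\<in>{0..T}. has_partial_x j (partial_x i (\<lambda>y. \<phi> y t)) x) \<and>
          continuous_on (UNIV \<times> {0..T}) (\<lambda>(x, t). partial_x j (partial_x i (\<lambda>y. \<phi> y t)) x)) \<and>
     C1_time T \<phi>"

text \<open>Test functions. The Caputo derivative of \<open>\<Delta>\<^sub>x\<phi>\<close> involves the time derivative of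
  \<open>\<Delta>\<^sub>x\<phi>\<close>, which \<open>C\<^sup>2\<^sup>,\<^sup>1\<close> alone does not provide. The second conjunct asks for it, so that
  the Caputo integral converges everywhere. Values of \<open>\<phi>\<close> outside the slab play no role.\<close>

definition test_function :: "real \<Rightarrow> (real^'n \<Rightarrow> real \<Rightarrow> real) \<Rightarrow> bool" where
  "test_function T \<phi> \<longleftrightarrow>
     C21 T \<phi> \<and>
     C1_time T (\<lambda>x t. laplacian (\<lambda>y. \<phi> y t) x) \<and>
     (\<exists>K. compact K \<and> (\<forall>x t. x \<notin> K \<and> t \<in> {0..T} \<longrightarrow> \<phi> x t = 0)) \<and>
     (\<forall>x. \<phi> x T = 0)"

text \<open>Meaningfulness of the integrals in the weak formulation is part of the notion of solution:
  each of them converges absolutely for every test function. It must not be used to discard test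
  functions instead, for then a locally integrable \<open>u\<close> whose power \<open>u\<^sup>p\<close> is integrable on no
  nonempty open set would have no test function except \<open>\<phi> = 0\<close> and would vacuously be a solution.

  Since \<open>\<phi>\<close>, \<open>\<phi>\<^sub>t\<close> and the Caputo term are taken to be zero for \<open>t > T\<close>, the integrals over
  \<^term>\<open>Omega_inf\<close> are integrals over \<^term>\<open>Omega T\<close>. The convention \<open>0 powr 0 = 0\<close> only
  affects the null set \<open>x = 0\<close> in the weight (when \<open>\<rho> = 0\<close>).\<close>

definition global_weak_solution ::
  "real \<Rightarrow> real \<Rightarrow> real \<Rightarrow> real \<Rightarrow> (real^'n \<Rightarrow> real) \<Rightarrow> ((real^'n) \<times> real \<Rightarrow> real) \<Rightarrow> bool" where
  "global_weak_solution \<alpha> \<rho> \<sigma> p u0 u \<longleftrightarrow>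
     (\<forall>K. compact K \<and> K \<subseteq> Omega_inf \<longrightarrow> u absolutely_integrable_on K) \<and>
     (\<forall>T>0. \<forall>\<phi>. test_function T \<phi> \<longrightarrow>
        (\<lambda>x. u0 x * \<phi> x 0) absolutely_integrable_on UNIV \<and>
        (\<lambda>(x, t). norm x powr \<rho> * t powr \<sigma> * u (x, t) powr p * \<phi> x t)
          absolutely_integrable_on Omega T \<and>
        (\<lambda>(x, t). u (x, t) * caputo_right \<alpha> T (\<lambda>s. laplacian (\<lambda>y. \<phi> y s) x) t)
          absolutely_integrable_on Omega T \<and>
        (\<lambda>(x, t). u (x, t) * deriv (\<phi> x) t) absolutely_integrable_on Omega T \<and>
        - (LINT x|lebesgue. u0 x * \<phi> x 0)
        - (LINT (x, t):Omega T|lebesgue. norm x powr \<rho> * t powr \<sigma> * u (x, t) powr p * \<phi> x t)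
        = (LINT (x, t):Omega T|lebesgue.
              u (x, t) * caputo_right \<alpha> T (\<lambda>s. laplacian (\<lambda>y. \<phi> y s) x) t)
        + (LINT (x, t):Omega T|lebesgue. u (x, t) * deriv (\<phi> x) t))"

end

theory Submission
  imports Defs
begin

text \<open>
  The weak formulation is tested with \<open>\<phi> = y\<^sup>3 \<tau> g(\<tau>) + B (y\<^sup>3 - y\<^sup>4) g(\<tau>)\<close>, where
  \<open>y = (1 - |x|\<^sup>2 / (\<Lambda> T\<^sup>\<alpha>))\<^sub>+\<close>, \<open>\<tau> = 1 - t / T\<close> and \<open>g(\<tau>) = (1 + M (1 - \<tau>)) \<tau>\<^sup>m\<close>.
  Let \<open>\<Phi>\<close> be the sum of \<open>\<phi>\<^sub>t\<close> and the Caputo derivative of \<open>\<Delta>\<phi>\<close>, so that the integral of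
  \<open>|x|\<^sup>\<rho> t\<^sup>\<sigma> u\<^sup>p \<phi>\<close> is at most that of \<open>-u \<Phi>\<close>.

  The usual cut-offs are not enough, because \<open>|x|\<^sup>\<rho> t\<^sup>\<sigma>\<close> raised to the power \<open>-1/(p - 1)\<close> need not
  be integrable near \<open>x = 0\<close> or \<open>t = 0\<close>. For \<open>m + 1 < M < (m + \<alpha>) / (1 - \<alpha>)\<close> the profiles
  increase near \<open>t = 0\<close> although their Caputo derivatives are positive; since \<open>\<Delta>\<phi>\<close> is bounded
  below by a multiple of \<open>-\<phi> / T\<^sup>\<alpha>\<close>, up to the time profiles, this gives \<open>\<Phi> \<ge> 0\<close> for \<open>t \<le> \<delta> T\<close>
  when \<open>\<Lambda>\<close> is large. Near \<open>x = 0\<close> the term \<open>B (y\<^sup>3 - y\<^sup>4)\<close>, which vanishes like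
  \<open>|x|\<^sup>2\<close>, is strictly subharmonic and for large \<open>B\<close> compensates everything except where
  \<open>|x|\<^sup>2\<close> dominates \<open>T\<^sup>\<alpha> \<tau>\<^sup>\<alpha>\<close>. Hence \<open>-T \<Phi> \<le> C (s\<^sup>\<rho>\<^sup>/\<^sup>2 \<phi>)\<^sup>1\<^sup>/\<^sup>p\<close> with \<open>s = 1 - y\<close>.

  By Young's inequality and \<open>p \<le> p\<^sub>c\<close>, \<open>X(T) = \<integral>|x|\<^sup>\<rho> t\<^sup>\<sigma> u\<^sup>p \<phi>\<close> satisfies
  \<open>X(T) \<le> C (K Y(T) + K\<^bsup>-1/(p-1)\<^esup>)\<close> for all \<open>K > 0\<close> and \<open>T \<ge> 1\<close>, where \<open>Y(T) \<le> X(T)\<close> is the part of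
  the integral with \<open>t \<ge> \<delta> T\<close>. A small \<open>K\<close> shows that \<open>X\<close> is bounded, so \<open>|x|\<^sup>\<rho> t\<^sup>\<sigma> u\<^sup>p\<close> is
  integrable by Fatou's lemma and \<open>Y(T) \<rightarrow> 0\<close>; a large \<open>K\<close> then gives \<open>X(T) \<rightarrow> 0\<close>. This treats the
  subcritical and the critical case at once.
\<close>

section \<open>Test function and defect\<close>

text \<open>Equals \<open>\<Gamma>(k + 1) / \<Gamma>(k + \<alpha>)\<close>, the factor in the Caputo derivative of \<open>(1 - t / T)\<^sup>k\<close>.\<close>

definition caputo_coeff :: "real \<Rightarrow> nat \<Rightarrow> real" where
  "caputo_coeff \<alpha> k = real k * Beta \<alpha> (real k) / Gamma \<alpha>"

text \<open>All time profiles are written in \<open>\<tau> = 1 - t / T\<close>. With \<open>\<theta> = t / T\<close>,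
  \<open>tprof_rate\<close> is the derivative of \<^term>\<open>tprof\<close> with respect to \<open>\<theta>\<close> (not \<open>\<tau>\<close>), and
  \<open>tprof_caputo\<close> its right Caputo derivative in \<open>\<theta>\<close>.\<close>

definition tprof :: "nat \<Rightarrow> real \<Rightarrow> real \<Rightarrow> real" where
  "tprof m M \<tau> = (1 + M) * \<tau> ^ m - M * \<tau> ^ (m + 1)"

definition tprof_rate :: "nat \<Rightarrow> real \<Rightarrow> real \<Rightarrow> real" where
  "tprof_rate m M \<tau> = M * real (m + 1) * \<tau> ^ m - (1 + M) * real m * \<tau> ^ (m - 1)"

definition tprof_caputo :: "real \<Rightarrow> nat \<Rightarrow> real \<Rightarrow> real \<Rightarrow> real" where
  "tprof_caputo \<alpha> m M \<tau> =
     (1 + M) * caputo_coeff \<alpha> m * \<tau> powr (\<alpha> + real m - 1)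
     - M * caputo_coeff \<alpha> (m + 1) * \<tau> powr (\<alpha> + real m)"

text \<open>A truncated paraboloid; \<open>q\<close> is the squared radius of its support and will
  be \<open>\<Lambda> * T powr \<alpha>\<close>.\<close>

definition bump :: "real \<Rightarrow> real^'n \<Rightarrow> real" where
  "bump q x = max 0 (1 - (norm x)\<^sup>2 / q)"

text \<open>The values of \<open>q \<Delta>(y\<^sup>3)\<close> and \<open>q \<Delta>(y\<^sup>3 - y\<^sup>4)\<close> for \<open>y = bump q x\<close> in dimension \<open>N\<close>; here
  \<open>|x|\<^sup>2 = q (1 - y)\<close> where \<open>y > 0\<close>.\<close>

definition lap0 :: "real \<Rightarrow> real \<Rightarrow> real" where
  "lap0 N y = 24 * (1 - y) * y - 6 * N * y\<^sup>2"

definition lap1 :: "real \<Rightarrow> real \<Rightarrow> real" where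
  "lap1 N y = lap0 N y - (48 * (1 - y) * y\<^sup>2 - 8 * N * y ^ 3)"

text \<open>Third powers are the least that make the truncation twice continuously differentiable.
  The main summand has one more power of \<tau> than the correction: its time derivative, of order
  \<open>\<tau> ^ m\<close>, can then be absorbed by the Caputo term of the correction, of order
  \<open>\<tau> powr (\<alpha> + real m - 1)\<close>.\<close>

definition profile :: "nat \<Rightarrow> real \<Rightarrow> real \<Rightarrow> real \<Rightarrow> real \<Rightarrow> real" where
  "profile m M B y \<tau> = y ^ 3 * tprof (m + 1) M \<tau> + B * (y ^ 3 - y ^ 4) * tprof m M \<tau>"

definition test_phi :: "nat \<Rightarrow> real \<Rightarrow> real \<Rightarrow> real \<Rightarrow> real \<Rightarrow> real^'n \<Rightarrow> real \<Rightarrow> real" where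
  "test_phi m M B q T x t = profile m M B (bump q x) (1 - t / T)"

text \<open>The quantity \<open>T \<Phi>\<close> of the introduction.\<close>

definition defect :: "real \<Rightarrow> real \<Rightarrow> nat \<Rightarrow> real \<Rightarrow> real \<Rightarrow> real \<Rightarrow> real \<Rightarrow> real \<Rightarrow> real" where
  "defect \<alpha> N m M B \<Lambda> y \<tau> =
     y ^ 3 * tprof_rate (m + 1) M \<tau> + B * (y ^ 3 - y ^ 4) * tprof_rate m M \<tau>
     + (lap0 N y * tprof_caputo \<alpha> (m + 1) M \<tau> + B * lap1 N y * tprof_caputo \<alpha> m M \<tau>) / \<Lambda>"

section \<open>Caputo derivatives of the time profiles\<close>

lemma caputo_coeff_pos: "0 < \<alpha> \<Longrightarrow> 0 < k \<Longrightarrow> 0 < caputo_coeff \<alpha> k"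
  unfolding caputo_coeff_def Beta_def
  by (intro divide_pos_pos mult_pos_pos Gamma_real_pos) auto

lemma caputo_coeff_Suc:
  assumes "0 < \<alpha>" "0 < k"
  shows "caputo_coeff \<alpha> (k + 1) = caputo_coeff \<alpha> k * (real k + 1) / (real k + \<alpha>)"
proof -
  have "(\<alpha> + real k) * Beta \<alpha> (real k + 1) = real k * Beta \<alpha> (real k)"
    using assms by (intro Beta_plus1_right) (auto elim!: nonpos_Ints_cases)
  then have "Beta \<alpha> (real k + 1) = real k * Beta \<alpha> (real k) / (real k + \<alpha>)"
    using assms by (simp add: field_simps)
  then show ?thesis
    by (simp add: caputo_coeff_def add.commute mult_ac)
qed

text \<open>The substitution \<open>s = t + (T - t) * x\<close> reduces the integral to
  \<open>Beta \<alpha> (real k)\<close>. The second factor is minus the derivative of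
  \<open>(1 - s / T) ^ k\<close>.\<close>

lemma integral_rl_power:
  assumes \<alpha>: "0 < \<alpha>" and k: "0 < k" and tT: "t < T" and T: "0 < T"
  shows "((\<lambda>s. (s - t) powr (\<alpha> - 1) * (real k * (1 - s / T) ^ (k - 1) / T)) has_integral
           Gamma \<alpha> * T powr (\<alpha> - 1) * caputo_coeff \<alpha> k * (1 - t / T) powr (\<alpha> + real k - 1)) {t<..<T}"
proof -
  define d where "d = T - t"
  have d: "0 < d" using tT by (simp add: d_def)
  have "((\<lambda>x. x powr (\<alpha> - 1) * (1 - x) powr (real k - 1)) has_integral Beta \<alpha> (real k)) (cbox 0 1)"
    using has_integral_Beta_real[of \<alpha> "real k"] \<alpha> k by simp
  from has_integral_affinity[OF this, of "1 / d" "- t / d"]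
  have "((\<lambda>s. ((s - t) / d) powr (\<alpha> - 1) * (1 - (s - t) / d) powr (real k - 1)) has_integral
        d * Beta \<alpha> (real k)) ((\<lambda>x. d * x + t) ` cbox 0 1)"
    using d by (simp add: algebra_simps diff_divide_distrib)
  also have "(\<lambda>x. d * x + t) ` cbox 0 1 = {t..T}"
    using image_affinity_cbox[of d t 0 1] d by (simp add: d_def)
  finally have "((\<lambda>s. ((s - t) / d) powr (\<alpha> - 1) * (1 - (s - t) / d) powr (real k - 1)) has_integral
        d * Beta \<alpha> (real k)) {t<..<T}"
    by (simp add: has_integral_Icc_iff_Ioo)
  then have I: "((\<lambda>s. d powr (\<alpha> - 1) * (d / T) ^ (k - 1) * (real k / T) *
        (((s - t) / d) powr (\<alpha> - 1) * (1 - (s - t) / d) powr (real k - 1))) has_integral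
        d powr (\<alpha> - 1) * (d / T) ^ (k - 1) * (real k / T) * (d * Beta \<alpha> (real k))) {t<..<T}"
    by (rule has_integral_mult_right)
  have eq: "d powr (\<alpha> - 1) * (d / T) ^ (k - 1) * (real k / T) *
        (((s - t) / d) powr (\<alpha> - 1) * (1 - (s - t) / d) powr (real k - 1))
        = (s - t) powr (\<alpha> - 1) * (real k * (1 - s / T) ^ (k - 1) / T)"
    if "s \<in> {t<..<T}" for s
  proof -
    have s: "t < s" "s < T" using that by auto
    have e: "1 - (s - t) / d = (T - s) / d" using d by (simp add: d_def field_simps)
    have p: "((T - s) / d) powr (real k - 1) = ((T - s) / d) ^ (k - 1)"
      using s d k powr_realpow[of "(T - s) / d" "k - 1"] by (simp add: of_nat_diff)
    have "1 - s / T = d / T * ((T - s) / d)"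
      using d T by (simp add: field_simps)
    then have q: "(1 - s / T) ^ (k - 1) = (d / T) ^ (k - 1) * ((T - s) / d) ^ (k - 1)"
      by (simp only: power_mult_distrib)
    have "s - t = d * ((s - t) / d)" using d by simp
    then have r: "(s - t) powr (\<alpha> - 1) = d powr (\<alpha> - 1) * ((s - t) / d) powr (\<alpha> - 1)"
      by (metis powr_mult)
    show ?thesis unfolding e p q r by simp
  qed
  have val: "d powr (\<alpha> - 1) * (d / T) ^ (k - 1) * (real k / T) * (d * Beta \<alpha> (real k))
      = Gamma \<alpha> * T powr (\<alpha> - 1) * caputo_coeff \<alpha> k * (1 - t / T) powr (\<alpha> + real k - 1)"
  proof -
    have e: "1 - t / T = d / T" using T by (simp add: d_def field_simps)
    have "(d / T) powr (\<alpha> + real k - 1) = (d / T) powr \<alpha> * (d / T) powr (real (k - 1))"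
      using k by (simp add: powr_add[symmetric] of_nat_diff algebra_simps)
    also have "\<dots> = d powr \<alpha> / T powr \<alpha> * (d / T) ^ (k - 1)"
      using d T by (simp add: powr_divide powr_realpow power_divide)
    finally have "(d / T) powr (\<alpha> + real k - 1) = d powr \<alpha> / T powr \<alpha> * (d / T) ^ (k - 1)" .
    moreover have "d powr (\<alpha> - 1) = d powr \<alpha> / d" "T powr (\<alpha> - 1) = T powr \<alpha> / T"
      using d T by (simp_all add: powr_diff)
    moreover have "Gamma \<alpha> \<noteq> 0" using Gamma_real_pos[OF \<alpha>] by simp
    ultimately show ?thesis using d T
      by (simp add: e caputo_coeff_def power_divide mult_ac)
  qed
  show ?thesis
    using has_integral_eq[OF eq I] unfolding val .
qed

text \<open>The integrand is nonnegative on the interval, so the gauge integral is also a Lebesgue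
  integral.\<close>

lemma set_integral_rl_power:
  assumes \<alpha>: "0 < \<alpha>" and k: "0 < k" and tT: "t < T" and T: "0 < T"
  shows "set_integrable lebesgue {t<..<T} (\<lambda>s. (s - t) powr (\<alpha> - 1) * (real k * (1 - s / T) ^ (k - 1) / T))" (is "set_integrable _ _ ?f")
    and "(LINT s:{t<..<T}|lebesgue. (s - t) powr (\<alpha> - 1) * (real k * (1 - s / T) ^ (k - 1) / T))
          = Gamma \<alpha> * T powr (\<alpha> - 1) * caputo_coeff \<alpha> k * (1 - t / T) powr (\<alpha> + real k - 1)"
proof -
  note I = integral_rl_power[OF assms]
  show 1: "set_integrable lebesgue {t<..<T} ?f"
    using I T by (intro nonnegative_absolutely_integrable_1) (auto simp: field_simps intro: has_integral_integrable)
  show "(LINT s:{t<..<T}|lebesgue. ?f s)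
          = Gamma \<alpha> * T powr (\<alpha> - 1) * caputo_coeff \<alpha> k * (1 - t / T) powr (\<alpha> + real k - 1)"
    using set_lebesgue_integral_eq_integral(2)[OF 1] integral_unique[OF I] by (rule trans)
qed

section \<open>From powers to the time profiles\<close>

lemma tprof_deriv:
  assumes "T \<noteq> 0"
  shows "((\<lambda>t. tprof m M (1 - t / T)) has_real_derivative tprof_rate m M (1 - t / T) / T) (at t within S)"
proof -
  have "((\<lambda>t. 1 - t / T) has_real_derivative - 1 / T) (at t within S)"
    using assms by (auto intro!: derivative_eq_intros)
  from DERIV_power[OF this]
  have "((\<lambda>t. (1 - t / T) ^ k) has_real_derivative real k * (1 - t / T) ^ (k - 1) * (- 1 / T)) (at t within S)" for k
    by (simp add: mult_ac)
  from DERIV_diff[OF DERIV_cmult[OF this[of m], of "1 + M"] DERIV_cmult[OF this[of "m + 1"], of M]]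
  show ?thesis
    unfolding tprof_def tprof_rate_def
    by (rule DERIV_cong) (simp add: diff_divide_distrib add_divide_distrib algebra_simps)
qed

text \<open>The derivative has order 1 - \<alpha>, so rescaling time by \<open>T\<close> produces
  \<open>T powr (\<alpha> - 1)\<close>. Both profiles are treated together because the Laplacian of
  the test function is such a combination at each point.\<close>

lemma caputo_right_tprof:
  assumes \<alpha>: "0 < \<alpha>" and m: "0 < m" and tT: "t < T" and T: "0 < T"
  shows "caputo_right \<alpha> T (\<lambda>s. a * tprof (m + 1) M (1 - s / T) + b * tprof m M (1 - s / T)) t =
    T powr (\<alpha> - 1) * (a * tprof_caputo \<alpha> (m + 1) M (1 - t / T) + b * tprof_caputo \<alpha> m M (1 - t / T))"
proof -
  let ?g = "\<lambda>s. a * tprof (m + 1) M (1 - s / T) + b * tprof m M (1 - s / T)"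
  let ?h = "\<lambda>k s. (s - t) powr (\<alpha> - 1) * (real k * (1 - s / T) ^ (k - 1) / T)"
  have "deriv ?g s = a * (tprof_rate (m + 1) M (1 - s / T) / T) + b * (tprof_rate m M (1 - s / T) / T)" for s
    using T by (intro DERIV_imp_deriv DERIV_add DERIV_cmult tprof_deriv) auto
  \<comment> \<open>Sorting by powers of \<open>x\<close> gives the integrands of the power rule for
    \<open>k = m + 2\<close>, \<open>m + 1\<close> and \<open>m\<close>.\<close>
  moreover have "z * (a * (tprof_rate (m + 1) M x / T) + b * (tprof_rate m M x / T)) =
     (a * M) * (z * (real (m + 2) * x ^ (m + 2 - 1) / T))
     + (b * M - a * (1 + M)) * (z * (real (m + 1) * x ^ (m + 1 - 1) / T))
     + (- b * (1 + M)) * (z * (real m * x ^ (m - 1) / T))" for x z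
    unfolding tprof_rate_def using T by (simp add: field_simps)
  ultimately have "(s - t) powr (\<alpha> - 1) * deriv ?g s =
     (a * M) * ?h (m + 2) s + (b * M - a * (1 + M)) * ?h (m + 1) s + (- b * (1 + M)) * ?h m s" for s
    by presburger
  then have "(LINT s:{t<..<T}|lebesgue. (s - t) powr (\<alpha> - 1) * deriv ?g s) =
     (a * M) * (LINT s:{t<..<T}|lebesgue. ?h (m + 2) s)
     + (b * M - a * (1 + M)) * (LINT s:{t<..<T}|lebesgue. ?h (m + 1) s)
     + (- b * (1 + M)) * (LINT s:{t<..<T}|lebesgue. ?h m s)"
    using set_integral_rl_power(1)[OF \<alpha> _ tT T] m
    by (simp only: set_integral_add set_integrable_mult_right set_integral_mult_right)
  also have "\<dots> = Gamma \<alpha> * T powr (\<alpha> - 1) *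
     ((a * M) * caputo_coeff \<alpha> (m + 2) * (1 - t / T) powr (\<alpha> + real m + 1)
     + (b * M - a * (1 + M)) * caputo_coeff \<alpha> (m + 1) * (1 - t / T) powr (\<alpha> + real m)
     + (- b * (1 + M)) * caputo_coeff \<alpha> m * (1 - t / T) powr (\<alpha> + real m - 1))"
    using m by (subst (1 2 3) set_integral_rl_power(2)[OF \<alpha> _ tT T]) (auto simp: algebra_simps)
  finally have I: "(LINT s:{t<..<T}|lebesgue. (s - t) powr (\<alpha> - 1) * deriv ?g s) = \<dots>" .
  have "Gamma \<alpha> \<noteq> 0" using Gamma_real_pos[OF \<alpha>] by simp
  then have "- (1 / Gamma \<alpha>) * (Gamma \<alpha> * T powr (\<alpha> - 1) * z) = T powr (\<alpha> - 1) * - z" for z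
    by simp
  then show ?thesis
    unfolding caputo_right_def I tprof_caputo_def by (simp only:) (simp add: algebra_simps)
qed

section \<open>Sign and size of the defect\<close>

text \<open>Completing the square: the positive linear term of \<open>lap0\<close> controls the
  negative quadratic one up to a multiple of \<open>y ^ 3\<close>, the main part of the test
  function itself. The constant is the one that \<open>lap1_ge\<close> needs as well.\<close>

lemma lap0_ge:
  assumes "0 \<le> y" "0 \<le> N"
  shows "lap0 N y \<ge> - ((48 + 8 * N)\<^sup>2 / 96) * y ^ 3"
proof -
  have "lap0 N y + ((48 + 8 * N)\<^sup>2 / 96) * y ^ 3
      = y * (24 * (1 - (48 + 8 * N) * y / 48)\<^sup>2) + (24 + 2 * N) * y\<^sup>2"
    by (simp add: lap0_def power2_eq_square power3_eq_cube field_simps)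
  also have "\<dots> \<ge> 0" using assms by simp
  finally show ?thesis by simp
qed

text \<open>The same square, now with the factor \<open>1 - y\<close> in front. The gain
  \<open>2 * N * y\<^sup>2\<close> is the strict subharmonicity near \<open>y = 1\<close>, that is,
  near the origin.\<close>

lemma lap1_ge:
  assumes "0 \<le> y" "y \<le> 1"
  shows "lap1 N y \<ge> 2 * N * y\<^sup>2 - ((48 + 8 * N)\<^sup>2 / 96) * (1 - y) * y ^ 3"
proof -
  have "lap1 N y - 2 * N * y\<^sup>2 + ((48 + 8 * N)\<^sup>2 / 96) * (1 - y) * y ^ 3
      = y * (1 - y) * (24 * (1 - (48 + 8 * N) * y / 48)\<^sup>2)"
    by (simp add: lap0_def lap1_def power2_eq_square power3_eq_cube field_simps)
  also have "\<dots> \<ge> 0" using assms by simp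
  finally show ?thesis by simp
qed

text \<open>Once \<open>\<tau> powr (\<alpha> + real m - 1)\<close> is factored out, the recursion
  for \<open>caputo_coeff\<close> leaves a nonincreasing affine function of \<tau>. Its values at 0
  and 1 give the two bounds.\<close>

lemma tprof_caputo_bounds:
  assumes \<alpha>: "0 < \<alpha>" and m: "0 < m" and M: "0 \<le> M" and \<tau>: "0 < \<tau>" "\<tau> \<le> 1"
  shows "tprof_caputo \<alpha> m M \<tau> \<le> (1 + M) * caputo_coeff \<alpha> m * \<tau> powr (\<alpha> + real m - 1)"
    and "tprof_caputo \<alpha> m M \<tau> \<ge>
      caputo_coeff \<alpha> m * (1 - M * (1 - \<alpha>) / (real m + \<alpha>)) * \<tau> powr (\<alpha> + real m - 1)"
proof -
  let ?q = "M * ((real m + 1) / (real m + \<alpha>))"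
  have "\<tau> powr (\<alpha> + real m) = \<tau> powr (\<alpha> + real m - 1) * \<tau>"
    using \<tau> by (simp add: powr_diff)
  then have eq: "tprof_caputo \<alpha> m M \<tau> = caputo_coeff \<alpha> m * (1 + M - ?q * \<tau>) * \<tau> powr (\<alpha> + real m - 1)"
    unfolding tprof_caputo_def caputo_coeff_Suc[OF \<alpha> m] by (simp add: algebra_simps)
  have c: "0 < caputo_coeff \<alpha> m" using caputo_coeff_pos[OF \<alpha> m] .
  have q: "0 \<le> ?q" using M \<alpha> by simp
  have "0 \<le> ?q * \<tau>" using mult_nonneg_nonneg[OF q less_imp_le[OF \<tau>(1)]] .
  then have "1 + M - ?q * \<tau> \<le> 1 + M" by linarith
  then show "tprof_caputo \<alpha> m M \<tau> \<le> (1 + M) * caputo_coeff \<alpha> m * \<tau> powr (\<alpha> + real m - 1)"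
    unfolding eq mult.commute[of "1 + M"] using c by (intro mult_right_mono mult_left_mono) auto
  have "1 - M * (1 - \<alpha>) / (real m + \<alpha>) = 1 + M - ?q"
    using \<alpha> by (simp add: field_simps)
  also have "?q * \<tau> \<le> ?q" using q \<tau> mult_left_le by blast
  then have "1 + M - ?q \<le> 1 + M - ?q * \<tau>" by simp
  finally show "tprof_caputo \<alpha> m M \<tau> \<ge>
      caputo_coeff \<alpha> m * (1 - M * (1 - \<alpha>) / (real m + \<alpha>)) * \<tau> powr (\<alpha> + real m - 1)"
    unfolding eq using c by (intro mult_right_mono mult_left_mono) auto
qed

section \<open>Rates of the time profiles and bounds for the test function\<close>

lemma tprof_rate_ge:
  assumes "0 \<le> M" "0 \<le> \<tau>"
  shows "tprof_rate m M \<tau> \<ge> - ((1 + M) * real m * \<tau> ^ (m - 1))"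
proof -
  have "0 \<le> M * real (m + 1) * \<tau> ^ m" using assms by (intro mult_nonneg_nonneg) auto
  then show ?thesis unfolding tprof_rate_def by linarith
qed

text \<open>At \<open>\<tau> = 1\<close>, the initial time, the rate equals
  \<open>M - real m\<close>; the rest is continuity.\<close>

lemma tprof_rate_near_1:
  assumes "real m < M"
  shows "\<exists>\<delta>>0. \<forall>\<tau>. 1 - \<delta> \<le> \<tau> \<longrightarrow> \<tau> \<le> 1 \<longrightarrow> (M - real m) / 2 \<le> tprof_rate m M \<tau>"
proof -
  have "continuous (at 1) (tprof_rate m M)"
    unfolding tprof_rate_def[abs_def] by (intro continuous_intros)
  moreover have "tprof_rate m M 1 = M - real m"
    by (simp add: tprof_rate_def algebra_simps)
  ultimately obtain d where d: "d > 0" "\<And>\<tau>. dist \<tau> 1 < d \<Longrightarrow> dist (tprof_rate m M \<tau>) (M - real m) < (M - real m) / 2"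
    using assms unfolding continuous_at_eps_delta by (metis diff_gt_0_iff_gt half_gt_zero)
  have "(M - real m) / 2 \<le> tprof_rate m M \<tau>" if "1 - d / 2 \<le> \<tau>" "\<tau> \<le> 1" for \<tau>
  proof -
    have "dist \<tau> 1 < d" using that d(1) by (simp add: dist_real_def)
    from d(2)[OF this] have "\<bar>tprof_rate m M \<tau> - (M - real m)\<bar> < (M - real m) / 2"
      by (simp only: dist_real_def)
    then show ?thesis unfolding abs_less_iff by (simp add: field_simps)
  qed
  with d(1) show ?thesis by (intro exI[of _ "d / 2"]) auto
qed

text \<open>The profile factors as \<open>y ^ 3 * \<tau> ^ m * (\<tau> + B * (1 - y)) * (1 + M * (1
  - \<tau>))\<close>. The bound keeps only the contribution of the correction.\<close>

lemma profile_ge: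
  assumes "0 \<le> M" "0 \<le> B" "0 \<le> y" "y \<le> 1" "0 \<le> \<tau>" "\<tau> \<le> 1"
  shows "profile m M B y \<tau> \<ge> B * (1 - y) * y ^ 3 * \<tau> ^ m"
proof -
  have "profile m M B y \<tau> = y ^ 3 * \<tau> ^ m * (\<tau> + B * (1 - y)) * (1 + M * (1 - \<tau>))"
    by (simp add: profile_def tprof_def algebra_simps power4_eq_xxxx power3_eq_cube)
  moreover have "y ^ 3 * \<tau> ^ m * (\<tau> + B * (1 - y)) * (1 + M * (1 - \<tau>)) \<ge> y ^ 3 * \<tau> ^ m * (B * (1 - y)) * 1"
    using assms by (intro mult_mono mult_nonneg_nonneg) auto
  ultimately show ?thesis by (simp add: mult_ac)
qed

lemma profile_nonneg:
  assumes "0 \<le> M" "0 \<le> B" "0 \<le> y" "y \<le> 1" "0 \<le> \<tau>" "\<tau> \<le> 1"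
  shows "profile m M B y \<tau> \<ge> 0"
  using order_trans[OF _ profile_ge[OF assms]] assms by simp

lemma profile_le:
  assumes "0 \<le> M" "0 \<le> B" "0 \<le> y" "y \<le> 1" "0 \<le> \<tau>" "\<tau> \<le> 1"
  shows "profile m M B y \<tau> \<le> (1 + B) * (1 + M)"
proof -
  have "profile m M B y \<tau> = y ^ 3 * \<tau> ^ m * (\<tau> + B * (1 - y)) * (1 + M * (1 - \<tau>))"
    by (simp add: profile_def tprof_def algebra_simps power4_eq_xxxx power3_eq_cube)
  also have "\<dots> \<le> 1 * 1 * (1 + B) * (1 + M)"
    using assms by (intro mult_mono add_mono mult_nonneg_nonneg add_nonneg_nonneg power_le_one)
      (auto intro: mult_left_le)
  finally show ?thesis by simp
qed

text \<open>The upper bound on \<open>M\<close> makes the Caputo derivatives of both profiles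
  nonnegative, so the lower bounds for \<open>lap0\<close> and \<open>lap1\<close> may be multiplied
  by them. The last summand is the gain from subharmonicity.\<close>

lemma defect_ge:
  assumes "0 < \<alpha>" "0 < m" "0 \<le> M" "M * (1 - \<alpha>) < real m + \<alpha>" "0 \<le> B" "0 < \<Lambda>" "0 \<le> N"
    and y: "0 \<le> y" "y \<le> 1" and \<tau>: "0 < \<tau>" "\<tau> \<le> 1"
  defines "K \<equiv> (48 + 8 * N)\<^sup>2 / 96"
  shows "defect \<alpha> N m M B \<Lambda> y \<tau> \<ge>
    y ^ 3 * (tprof_rate (m + 1) M \<tau> - K / \<Lambda> * tprof_caputo \<alpha> (m + 1) M \<tau>)
    + B * (1 - y) * y ^ 3 * (tprof_rate m M \<tau> - K / \<Lambda> * tprof_caputo \<alpha> m M \<tau>)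
    + 2 * N * B / \<Lambda> * tprof_caputo \<alpha> m M \<tau> * y\<^sup>2"
proof -
  have D: "0 \<le> tprof_caputo \<alpha> (m + i) M \<tau>" for i
  proof -
    have "M * (1 - \<alpha>) < real (m + i) + \<alpha>" using assms by simp
    then have "0 \<le> 1 - M * (1 - \<alpha>) / (real (m + i) + \<alpha>)" using assms by simp
    then show ?thesis
      using assms caputo_coeff_pos[of \<alpha> "m + i"]
      by (intro order_trans[OF _ tprof_caputo_bounds(2)]) (auto intro!: mult_nonneg_nonneg)
  qed
  have "lap0 N y * tprof_caputo \<alpha> (m + 1) M \<tau> \<ge> - K * y ^ 3 * tprof_caputo \<alpha> (m + 1) M \<tau>"
    using lap0_ge[of y N] assms D[of 1] by (intro mult_right_mono) auto
  moreover have "B * lap1 N y * tprof_caputo \<alpha> m M \<tau> \<ge> B * (2 * N * y\<^sup>2 - K * (1 - y) * y ^ 3) * tprof_caputo \<alpha> m M \<tau>"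
    using lap1_ge[of y N] assms D[of 0] by (intro mult_right_mono mult_left_mono) auto
  ultimately have "(lap0 N y * tprof_caputo \<alpha> (m + 1) M \<tau> + B * lap1 N y * tprof_caputo \<alpha> m M \<tau>) / \<Lambda> \<ge>
    (- K * y ^ 3 * tprof_caputo \<alpha> (m + 1) M \<tau> + B * (2 * N * y\<^sup>2 - K * (1 - y) * y ^ 3) * tprof_caputo \<alpha> m M \<tau>) / \<Lambda>"
    using \<open>0 < \<Lambda>\<close> by (intro divide_right_mono add_mono) auto
  moreover have "y ^ 3 - y ^ 4 = (1 - y) * y ^ 3"
    by (simp add: algebra_simps power4_eq_xxxx power3_eq_cube)
  ultimately have "defect \<alpha> N m M B \<Lambda> y \<tau> \<ge>
     y ^ 3 * tprof_rate (m + 1) M \<tau> + B * ((1 - y) * y ^ 3) * tprof_rate m M \<tau> +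
     (- K * y ^ 3 * tprof_caputo \<alpha> (m + 1) M \<tau> + B * (2 * N * y\<^sup>2 - K * (1 - y) * y ^ 3) * tprof_caputo \<alpha> m M \<tau>) / \<Lambda>"
    unfolding defect_def by simp
  also have "y ^ 3 * tprof_rate (m + 1) M \<tau> + B * ((1 - y) * y ^ 3) * tprof_rate m M \<tau> +
     (- K * y ^ 3 * tprof_caputo \<alpha> (m + 1) M \<tau> + B * (2 * N * y\<^sup>2 - K * (1 - y) * y ^ 3) * tprof_caputo \<alpha> m M \<tau>) / \<Lambda>
     = y ^ 3 * (tprof_rate (m + 1) M \<tau> - K / \<Lambda> * tprof_caputo \<alpha> (m + 1) M \<tau>)
    + B * (1 - y) * y ^ 3 * (tprof_rate m M \<tau> - K / \<Lambda> * tprof_caputo \<alpha> m M \<tau>)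
    + 2 * N * B / \<Lambda> * tprof_caputo \<alpha> m M \<tau> * y\<^sup>2"
    using \<open>0 < \<Lambda>\<close> by (simp add: field_simps)
  finally show ?thesis .
qed


text \<open>The constants are chosen in the order \<open>m\<close>, \<open>M\<close>, \<delta>,
  \<Lambda>, \<open>B\<close>, \<open>C\<close>, each depending only on the earlier ones and the
  data. The first inequality controls early times; the second is the form to which Young's
  inequality applies.\<close>

lemma exists_test_parameters:
  fixes \<alpha> \<rho> p N :: real
  assumes \<alpha>: "0 < \<alpha>" "\<alpha> < 1" and \<rho>: "0 \<le> \<rho>" and p: "1 < p" and N: "0 < N"
  obtains m M B \<Lambda> \<delta> C where
    "0 < m" "0 < M" "0 < B" "0 < \<Lambda>" "0 < \<delta>" "\<delta> < 1" "0 < C"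
    "\<And>y \<tau>. \<lbrakk>0 \<le> y; y \<le> 1; 0 < \<tau>; \<tau> \<le> 1; 1 - \<delta> \<le> \<tau>\<rbrakk> \<Longrightarrow> 0 \<le> defect \<alpha> N m M B \<Lambda> y \<tau>"
    "\<And>y \<tau>. \<lbrakk>0 \<le> y; y \<le> 1; 0 < \<tau>; \<tau> \<le> 1\<rbrakk> \<Longrightarrow>
       - defect \<alpha> N m M B \<Lambda> y \<tau> \<le> C * ((1 - y) powr (\<rho> / 2) * profile m M B y \<tau>) powr (1 / p)"
proof -
  define K where "K = (48 + 8 * N)\<^sup>2 / 96"
  have K: "0 < K" using N by (simp add: K_def)
  \<comment> \<open>The first bound leaves room for \<open>M\<close>; the second makes the exponent
    \<open>e\<close>, left over when \<open>\<tau> ^ (m - 1)\<close> is compared with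
    \<open>(\<tau> ^ m) powr (1 / p)\<close>, large enough.\<close>
  obtain m :: nat where m: "max (1 / \<alpha>) ((1 + \<alpha> * (\<rho> / 2 + 1) / p) / (1 - 1 / p)) < real m"
    using reals_Archimedean2 by blast
  have m1: "1 < real m * \<alpha>" using m \<alpha> by (simp add: field_simps)
  have m0: "0 < m" using m1 \<alpha> by (cases m) auto
  define e where "e = real m - 1 - real m / p"
  have "1 + \<alpha> * (\<rho> / 2 + 1) / p < real m * (1 - 1 / p)"
    using m p by (simp add: divide_less_eq)
  then have e: "\<alpha> * (\<rho> / 2 + 1) / p < e" by (simp add: e_def algebra_simps)
  have "real m + 1 < (real m + \<alpha>) / (1 - \<alpha>)"
    using m1 \<alpha> by (simp add: field_simps)
  \<comment> \<open>The lower bound makes both rates positive at \<open>\<tau> = 1\<close>, the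
    upper one keeps the Caputo derivatives positive.\<close>
  then obtain M where M: "real m + 1 < M" "M < (real m + \<alpha>) / (1 - \<alpha>)"
    using dense by blast
  have M0: "0 < M" using M by linarith
  have M2: "M * (1 - \<alpha>) < real m + \<alpha>" using M(2) \<alpha> by (simp add: field_simps)
  obtain d0 where d0: "d0 > 0" "\<And>\<tau>. 1 - d0 \<le> \<tau> \<Longrightarrow> \<tau> \<le> 1 \<Longrightarrow> (M - real m) / 2 \<le> tprof_rate m M \<tau>"
    using tprof_rate_near_1[of m M] M by auto
  obtain d1 where d1: "d1 > 0" "\<And>\<tau>. 1 - d1 \<le> \<tau> \<Longrightarrow> \<tau> \<le> 1 \<Longrightarrow> (M - real (m + 1)) / 2 \<le> tprof_rate (m + 1) M \<tau>"
    using tprof_rate_near_1[of "m + 1" M] M by auto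
  define \<delta> where "\<delta> = min (1 / 2) (min d0 d1)"
  have \<delta>: "0 < \<delta>" "\<delta> < 1" "\<delta> \<le> d0" "\<delta> \<le> d1" using d0 d1 by (auto simp: \<delta>_def)
  define c0 c1 where "c0 = caputo_coeff \<alpha> m" and "c1 = caputo_coeff \<alpha> (m + 1)"
  have c: "0 < c0" "0 < c1" using caputo_coeff_pos \<alpha> m0 by (auto simp: c0_def c1_def)
  \<comment> \<open>A wide support weakens diffusion: with this value its loss is at most half of
    the smaller initial rate \<open>M - real m - 1\<close>.\<close>
  define \<Lambda> where "\<Lambda> = 2 * K * ((1 + M) * (c0 + c1)) / (M - real m - 1)"
  have \<Lambda>: "0 < \<Lambda>" using K M M0 c by (simp add: \<Lambda>_def)
  have KL: "K / \<Lambda> * ((1 + M) * (c0 + c1)) = (M - real m - 1) / 2"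
  proof -
    have *: "K / (2 * K * P / g) * P = g / 2" if "P \<noteq> 0" "g \<noteq> 0" for P g
      using K that by simp
    show ?thesis
      unfolding \<Lambda>_def using M M0 c by (intro *) auto
  qed
  have D0: "tprof_caputo \<alpha> m M \<tau> \<le> (1 + M) * c0 * \<tau> powr (\<alpha> + real m - 1)"
    and D1: "tprof_caputo \<alpha> (m + 1) M \<tau> \<le> (1 + M) * c1 * \<tau> powr (\<alpha> + real m)"
    if "0 < \<tau>" "\<tau> \<le> 1" for \<tau>
    using tprof_caputo_bounds(1)[OF \<alpha>(1) m0 _ that, of M]
      tprof_caputo_bounds(1)[OF \<alpha>(1), of "m + 1" M, OF _ _ that] M0
    by (auto simp: c0_def c1_def)
  have le1: "\<tau> powr x \<le> 1" if "0 < \<tau>" "\<tau> \<le> 1" "0 \<le> x" for \<tau> x :: real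
    using that powr_mono2[of x \<tau> 1] by simp
  define \<kappa> where "\<kappa> = c0 * (1 - M * (1 - \<alpha>) / (real m + \<alpha>))"
  have \<kappa>: "0 < \<kappa>" using M2 c \<alpha> by (simp add: \<kappa>_def)
  have D0': "\<kappa> * \<tau> powr (\<alpha> + real m - 1) \<le> tprof_caputo \<alpha> m M \<tau>" if "0 < \<tau>" "\<tau> \<le> 1" for \<tau>
    using tprof_caputo_bounds(2)[OF \<alpha>(1) m0 _ that, of M] M0 by (simp add: \<kappa>_def c0_def)
  define C1 where "C1 = (1 + M) * real (m + 1) + K / \<Lambda> * ((1 + M) * c1)"
  define C2 where "C2 = (1 + M) * real m + K / \<Lambda> * ((1 + M) * c0)"
  have C: "0 < C1" "0 < C2"
    unfolding C1_def C2_def using K \<Lambda> M0 c m0 by (auto intro!: add_pos_pos mult_pos_pos)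
  \<comment> \<open>\<open>C1\<close> and \<open>C2\<close> bound the losses of the main part and of
    the correction. This \<open>B\<close> makes the subharmonic gain twice \<open>C1\<close>: one
    half pays for the main part, the other is left to fight the loss of the correction.\<close>
  define B where "B = C1 * \<Lambda> / (N * \<kappa>)"
  have B: "0 < B" using C \<Lambda> N \<kappa> by (simp add: B_def)
  have NB: "N * B / \<Lambda> * \<kappa> = C1" using C \<Lambda> N \<kappa> by (simp add: B_def)
  \<comment> \<open>For \<open>1 - y \<le> \<epsilon> * \<tau> powr \<alpha>\<close> the remaining
    gain covers the loss \<open>B * C2 * (1 - y)\<close> of the correction.\<close>
  define \<epsilon> where "\<epsilon> = C1 / (B * C2)"
  have \<epsilon>: "0 < \<epsilon>" using B C by (simp add: \<epsilon>_def)
  define C where "C = B * C2 * (1 / \<epsilon>) powr (e / \<alpha>) * (1 / B) powr (1 / p)"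
  have C0: "0 < C" using B C(2) \<epsilon> by (simp add: C_def)

  have near: "0 \<le> defect \<alpha> N m M B \<Lambda> y \<tau>"
    if y: "0 \<le> y" "y \<le> 1" and \<tau>: "0 < \<tau>" "\<tau> \<le> 1" "1 - \<delta> \<le> \<tau>" for y \<tau>
  proof -
    have KL0: "0 \<le> K / \<Lambda>" using K \<Lambda> by simp
    have "tprof_caputo \<alpha> m M \<tau> \<le> (1 + M) * c0 * 1"
      using m0 \<alpha> \<tau> M0 c
      by (intro order_trans[OF D0 mult_left_mono[OF le1]]) auto
    also have "\<dots> \<le> (1 + M) * (c0 + c1)" using c M0 by (simp add: distrib_left)
    finally have "K / \<Lambda> * tprof_caputo \<alpha> m M \<tau> \<le> (M - real m - 1) / 2"
      using mult_left_mono[OF _ KL0] KL by metis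
    moreover have "(M - real m) / 2 \<le> tprof_rate m M \<tau>" using \<delta> \<tau> by (intro d0(2)) auto
    ultimately have 0: "0 \<le> tprof_rate m M \<tau> - K / \<Lambda> * tprof_caputo \<alpha> m M \<tau>"
      by argo
    have "tprof_caputo \<alpha> (m + 1) M \<tau> \<le> (1 + M) * c1 * 1"
      using m0 \<alpha> \<tau> M0 c
      by (intro order_trans[OF D1 mult_left_mono[OF le1]]) auto
    also have "\<dots> \<le> (1 + M) * (c0 + c1)" using c M0 by (simp add: distrib_left)
    finally have "K / \<Lambda> * tprof_caputo \<alpha> (m + 1) M \<tau> \<le> (M - real m - 1) / 2"
      using mult_left_mono[OF _ KL0] KL by metis
    moreover have "(M - real (m + 1)) / 2 \<le> tprof_rate (m + 1) M \<tau>" using \<delta> \<tau> by (intro d1(2)) auto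
    ultimately have 1: "0 \<le> tprof_rate (m + 1) M \<tau> - K / \<Lambda> * tprof_caputo \<alpha> (m + 1) M \<tau>"
      unfolding of_nat_add of_nat_1 by argo
    have "0 \<le> \<kappa> * \<tau> powr (\<alpha> + real m - 1)" using \<kappa> by simp
    then have 2: "0 \<le> tprof_caputo \<alpha> m M \<tau>" using D0'[OF \<tau>(1,2)] by linarith
    show ?thesis
      using defect_ge[OF \<alpha>(1) m0 less_imp_le[OF M0] M2 less_imp_le[OF B] \<Lambda> less_imp_le[OF N] y \<tau>(1,2)]
        0 1 2 B N \<Lambda> y unfolding K_def[symmetric]
      by (elim order_trans[rotated]) (auto intro!: add_nonneg_nonneg mult_nonneg_nonneg)
  qed

  have far: "- defect \<alpha> N m M B \<Lambda> y \<tau> \<le> C * ((1 - y) powr (\<rho> / 2) * profile m M B y \<tau>) powr (1 / p)"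
    if y: "0 \<le> y" "y \<le> 1" and \<tau>: "0 < \<tau>" "\<tau> \<le> 1" for y \<tau>
  proof -
    let ?s = "1 - y"
    have KL0: "0 \<le> K / \<Lambda>" using K \<Lambda> by simp
    have \<tau>m: "\<tau> powr (\<alpha> + real m - 1) = \<tau> ^ (m - 1) * \<tau> powr \<alpha>"
      using \<tau> m0 by (simp add: powr_realpow[symmetric] powr_add[symmetric] of_nat_diff algebra_simps)
    have \<tau>m': "\<tau> powr (\<alpha> + real m) = \<tau> ^ m * \<tau> powr \<alpha>"
      using \<tau> by (simp add: powr_realpow[symmetric] powr_add[symmetric] algebra_simps)
    have \<tau>\<alpha>: "\<tau> powr \<alpha> \<le> 1" "\<tau> \<le> \<tau> powr \<alpha>"
      using le1[OF \<tau>, of \<alpha>] powr_mono'[of \<alpha> 1 \<tau>] \<alpha> \<tau> by auto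
    have "tprof_caputo \<alpha> (m + 1) M \<tau> \<le> (1 + M) * c1 * \<tau> ^ m"
      using D1[OF \<tau>] \<tau>\<alpha> \<tau> c M0 unfolding \<tau>m'
      by (elim order_trans) (auto intro!: mult_left_mono simp: mult_left_le)
    then have "K / \<Lambda> * tprof_caputo \<alpha> (m + 1) M \<tau> \<le> K / \<Lambda> * ((1 + M) * c1 * \<tau> ^ m)"
      using KL0 by (rule mult_left_mono)
    then have 1: "- (C1 * \<tau> ^ m) \<le> tprof_rate (m + 1) M \<tau> - K / \<Lambda> * tprof_caputo \<alpha> (m + 1) M \<tau>"
      using tprof_rate_ge[of M \<tau> "m + 1"] M0 \<tau> unfolding C1_def by (simp add: algebra_simps)
    have "tprof_caputo \<alpha> m M \<tau> \<le> (1 + M) * c0 * \<tau> ^ (m - 1)"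
      using D0[OF \<tau>] \<tau>\<alpha> \<tau> c M0 unfolding \<tau>m
      by (elim order_trans) (auto intro!: mult_left_mono simp: mult_left_le)
    then have "K / \<Lambda> * tprof_caputo \<alpha> m M \<tau> \<le> K / \<Lambda> * ((1 + M) * c0 * \<tau> ^ (m - 1))"
      using KL0 by (rule mult_left_mono)
    then have 0: "- (C2 * \<tau> ^ (m - 1)) \<le> tprof_rate m M \<tau> - K / \<Lambda> * tprof_caputo \<alpha> m M \<tau>"
      using tprof_rate_ge[of M \<tau> m] M0 \<tau> unfolding C2_def by (simp add: algebra_simps)
    \<comment> \<open>Giving up one power of \<open>y\<close> in the gain puts all terms over the
      common factor \<open>y ^ 3 * \<tau> ^ (m - 1)\<close>.\<close>
    have y32: "y ^ 3 \<le> y\<^sup>2" using y by (intro power_decreasing) auto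
    have "2 * C1 * (\<tau> ^ (m - 1) * \<tau> powr \<alpha>) * y ^ 3 \<le> 2 * C1 * (\<tau> ^ (m - 1) * \<tau> powr \<alpha>) * y\<^sup>2"
      using y32 C \<tau> by (intro mult_left_mono) auto
    also have "\<dots> = 2 * N * B / \<Lambda> * (\<kappa> * \<tau> powr (\<alpha> + real m - 1)) * y\<^sup>2"
      unfolding NB[symmetric] \<tau>m by (simp add: mult_ac)
    also have "\<dots> \<le> 2 * N * B / \<Lambda> * tprof_caputo \<alpha> m M \<tau> * y\<^sup>2"
      using D0'[OF \<tau>] N B \<Lambda> by (intro mult_right_mono mult_left_mono) auto
    finally have 2: "2 * C1 * (\<tau> ^ (m - 1) * \<tau> powr \<alpha>) * y ^ 3 \<le> 2 * N * B / \<Lambda> * tprof_caputo \<alpha> m M \<tau> * y\<^sup>2" .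
    have "\<tau> ^ m = \<tau> ^ (m - 1) * \<tau>" using m0 by (cases m) auto
    then have 3: "y ^ 3 * - (C1 * (\<tau> ^ (m - 1) * \<tau> powr \<alpha>)) \<le> y ^ 3 * - (C1 * \<tau> ^ m)"
      using \<tau>\<alpha> \<tau> C y by (intro mult_left_mono) auto
    have "y ^ 3 * \<tau> ^ (m - 1) * (C1 * \<tau> powr \<alpha> - B * C2 * ?s)
        = y ^ 3 * - (C1 * (\<tau> ^ (m - 1) * \<tau> powr \<alpha>)) + B * ?s * y ^ 3 * - (C2 * \<tau> ^ (m - 1))
          + 2 * C1 * (\<tau> ^ (m - 1) * \<tau> powr \<alpha>) * y ^ 3"
      by (simp add: algebra_simps)
    also have "\<dots> \<le> y ^ 3 * (tprof_rate (m + 1) M \<tau> - K / \<Lambda> * tprof_caputo \<alpha> (m + 1) M \<tau>)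
       + B * ?s * y ^ 3 * (tprof_rate m M \<tau> - K / \<Lambda> * tprof_caputo \<alpha> m M \<tau>)
       + 2 * N * B / \<Lambda> * tprof_caputo \<alpha> m M \<tau> * y\<^sup>2"
      using y B by (intro add_mono 2 order_trans[OF 3] mult_left_mono 1 0 mult_nonneg_nonneg) auto
    also have "\<dots> \<le> defect \<alpha> N m M B \<Lambda> y \<tau>"
      using defect_ge[OF \<alpha>(1) m0 less_imp_le[OF M0] M2 less_imp_le[OF B] \<Lambda> less_imp_le[OF N] y \<tau>]
      unfolding K_def[symmetric] .
    finally have main: "y ^ 3 * \<tau> ^ (m - 1) * (C1 * \<tau> powr \<alpha> - B * C2 * ?s) \<le> defect \<alpha> N m M B \<Lambda> y \<tau>" .
    show ?thesis
    proof (cases "?s \<le> \<epsilon> * \<tau> powr \<alpha>")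
      case True
      then have "B * C2 * ?s \<le> B * C2 * (\<epsilon> * \<tau> powr \<alpha>)" using B C by (intro mult_left_mono) auto
      also have "\<dots> = C1 * \<tau> powr \<alpha>" using B C by (simp add: \<epsilon>_def)
      finally have "0 \<le> y ^ 3 * \<tau> ^ (m - 1) * (C1 * \<tau> powr \<alpha> - B * C2 * ?s)"
        using y \<tau> by simp
      with main have "- defect \<alpha> N m M B \<Lambda> y \<tau> \<le> 0" by linarith
      also have "0 \<le> C * ((1 - y) powr (\<rho> / 2) * profile m M B y \<tau>) powr (1 / p)" using C0 by simp
      finally show ?thesis .
    next
      case False
      txt \<open>Here \<open>\<tau>\<close> is bounded by a power of \<open>1 - y\<close>, which absorbs the weight as \<open>m\<close> is large.\<close>
      from False have s: "0 < ?s" "\<tau> powr \<alpha> \<le> 1 / \<epsilon> * ?s"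
      proof -
        have "0 < \<epsilon> * \<tau> powr \<alpha>" using \<epsilon> \<tau> by simp
        with False show "0 < ?s" by linarith
        show "\<tau> powr \<alpha> \<le> 1 / \<epsilon> * ?s" using False \<epsilon> by (simp add: field_simps)
      qed
      have "- defect \<alpha> N m M B \<Lambda> y \<tau> \<le> y ^ 3 * \<tau> ^ (m - 1) * (B * C2 * ?s - C1 * \<tau> powr \<alpha>)"
        using main by (simp add: algebra_simps)
      also have "\<dots> \<le> y ^ 3 * \<tau> ^ (m - 1) * (B * C2 * ?s)"
        using y \<tau> C by (intro mult_left_mono) auto
      also have "\<dots> = B * C2 * (y ^ 3 * (\<tau> ^ (m - 1) * ?s))" by simp
      also have "\<dots> \<le> B * C2 * ((y ^ 3) powr (1 / p) *
         ((1 / \<epsilon>) powr (e / \<alpha>) * (\<tau> ^ m) powr (1 / p) * (?s powr (\<rho> / 2) * ?s) powr (1 / p)))"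
      proof (rule mult_left_mono, rule mult_mono)
        show "y ^ 3 \<le> (y ^ 3) powr (1 / p)"
          using powr_mono'[of "1 / p" 1 "y ^ 3"] p y by (cases "y = 0") (auto simp: power_le_one)
        have "\<tau> ^ (m - 1) = \<tau> powr (real m / p + e)"
          using \<tau> m0 by (simp add: e_def powr_realpow[symmetric] of_nat_diff)
        also have "\<dots> = (\<tau> ^ m) powr (1 / p) * (\<tau> powr \<alpha>) powr (e / \<alpha>)"
          using \<tau> \<alpha> by (simp add: powr_add powr_powr powr_realpow[symmetric])
        also have "(\<tau> powr \<alpha>) powr (e / \<alpha>) \<le> (1 / \<epsilon> * ?s) powr (e / \<alpha>)"
        proof (intro powr_mono2 s)
          have "0 \<le> \<alpha> * (\<rho> / 2 + 1) / p" using \<alpha> \<rho> p by simp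
          then show "0 \<le> e / \<alpha>" using e \<alpha> by simp
        qed simp
        also have "\<dots> = (1 / \<epsilon>) powr (e / \<alpha>) * ?s powr (e / \<alpha>)"
          by (simp only: powr_mult)
        finally have "\<tau> ^ (m - 1) * ?s \<le> (\<tau> ^ m) powr (1 / p) * ((1 / \<epsilon>) powr (e / \<alpha>) * ?s powr (e / \<alpha>)) * ?s"
          using s by (simp add: mult_left_mono)
        also have "\<dots> = (1 / \<epsilon>) powr (e / \<alpha>) * (\<tau> ^ m) powr (1 / p) * (?s powr (1 + e / \<alpha>))"
          using s by (simp add: powr_add)
        \<comment> \<open>The base is at most 1, so only exponents matter; the second lower bound on
          \<open>m\<close> gives \<open>(\<rho> / 2 + 1) / p \<le> e / \<alpha>\<close>. Of the
          exponent \<open>\<rho> / 2 + 1\<close>, the weight takes \<open>\<rho> / 2\<close> and the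
          factor \<open>1 - y\<close> of the correction takes 1.\<close>
        also have "?s powr (1 + e / \<alpha>) \<le> ?s powr ((\<rho> / 2 + 1) * (1 / p))"
        proof (rule powr_mono')
          have "(\<rho> / 2 + 1) * (1 / p) \<le> e / \<alpha>" using e \<alpha> by (simp add: field_simps)
          then show "(\<rho> / 2 + 1) * (1 / p) \<le> 1 + e / \<alpha>" by simp
        qed (use s y in auto)
        also have "\<dots> = (?s powr (\<rho> / 2) * ?s) powr (1 / p)"
        proof -
          have "?s powr (\<rho> / 2 + 1) = ?s powr (\<rho> / 2) * ?s" using s by (simp add: powr_add)
          then show ?thesis using powr_powr[of ?s "\<rho> / 2 + 1" "1 / p"] by simp
        qed
        finally show "\<tau> ^ (m - 1) * ?s \<le> (1 / \<epsilon>) powr (e / \<alpha>) * (\<tau> ^ m) powr (1 / p) * (?s powr (\<rho> / 2) * ?s) powr (1 / p)"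
          by (simp add: mult_left_mono)
      qed (use y \<tau> B C in auto)
      also have "\<dots> = C * (?s powr (\<rho> / 2) * (B * ?s * y ^ 3 * \<tau> ^ m)) powr (1 / p)"
        using B by (simp add: C_def powr_mult powr_divide)
      also have "\<dots> \<le> C * (?s powr (\<rho> / 2) * profile m M B y \<tau>) powr (1 / p)"
        using profile_ge[of M B y \<tau> m] M0 B y \<tau> C0 p
        by (intro mult_left_mono powr_mono2) auto
      finally show ?thesis .
    qed
  qed
  show thesis
    using that[OF m0 M0 B \<Lambda> \<delta>(1,2) C0] near far by blast
qed

section \<open>Admissibility of the test function\<close>

text \<open>At the kink, Caratheodory's slope function is \<open>max 0 z ^ (k - 1)\<close>, which
  vanishes there because \<open>k\<close> is at least 2.\<close>

lemma DERIV_max_0_power: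
  assumes "2 \<le> k"
  shows "((\<lambda>z. max 0 z ^ k) has_real_derivative real k * max 0 z ^ (k - 1)) (at z)"
proof -
  consider "z < 0" | "z = 0" | "z > 0" by linarith
  then show ?thesis
  proof cases
    case 1
    have "((\<lambda>z. 0) has_real_derivative 0) (at z)" by simp
    then have "((\<lambda>z. max 0 z ^ k) has_real_derivative 0) (at z)"
      by (rule has_field_derivative_transform_within_open[where S = "{..<0}"]) (use 1 assms in auto)
    then show ?thesis using 1 assms by (simp add: power_0_left)
  next
    case 2
    have "isCont (\<lambda>z. max 0 z ^ (k - 1)) (0::real)" by (intro continuous_intros)
    moreover have "max 0 z ^ k = max 0 z ^ (k - 1) * z" for z :: real
      using assms by (cases k) (auto simp: max_def)
    ultimately show ?thesis
      unfolding CARAT_DERIV using 2 assms by (intro exI[of _ "\<lambda>z. max 0 z ^ (k - 1)"]) auto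
  next
    case 3
    have "((\<lambda>z. z ^ k) has_real_derivative real k * z ^ (k - 1)) (at z)"
      using DERIV_pow[of k z] by simp
    then have "((\<lambda>z. max 0 z ^ k) has_real_derivative real k * z ^ (k - 1)) (at z)"
      by (rule has_field_derivative_transform_within_open[where S = "{0<..}"]) (use 3 in auto)
    then show ?thesis using 3 by simp
  qed
qed

section \<open>Spatial derivatives of the test function\<close>

lemma has_partial_bump_power:
  fixes x :: "real^'n"
  assumes "2 \<le> k"
  shows "((\<lambda>h. bump q (x + h *\<^sub>R axis i 1) ^ k) has_real_derivative
      - (2 * real k / q) * (x $ i * bump q x ^ (k - 1))) (at 0)"
proof -
  have n2: "(norm (x + h *\<^sub>R axis i 1))\<^sup>2 = (norm x)\<^sup>2 + 2 * h * x $ i + h\<^sup>2" for h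
    unfolding power2_norm_eq_inner
    by (simp add: inner_add_left inner_add_right inner_axis inner_axis' power2_eq_square algebra_simps)
  have "((\<lambda>h. 1 - (norm (x + h *\<^sub>R axis i 1))\<^sup>2 / q) has_real_derivative - (2 * x $ i / q)) (at 0)"
    unfolding n2 divide_inverse by (auto intro!: derivative_eq_intros)
  from DERIV_chain2[OF DERIV_max_0_power[OF assms] this]
  show ?thesis by (simp add: bump_def mult_ac)
qed

lemma has_partial_nth_bump_power:
  fixes x :: "real^'n"
  assumes "2 \<le> k"
  shows "((\<lambda>h. (x + h *\<^sub>R axis j 1) $ i * bump q (x + h *\<^sub>R axis j 1) ^ k) has_real_derivative
      (if i = j then bump q x ^ k else 0)
      - (2 * real k / q) * (x $ i * (x $ j * bump q x ^ (k - 1)))) (at 0)"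
proof -
  have "((\<lambda>h. x $ i + h * axis j 1 $ i) has_real_derivative axis j 1 $ i) (at 0)"
    by (auto intro!: derivative_eq_intros)
  then have "((\<lambda>h. (x + h *\<^sub>R axis j 1) $ i) has_real_derivative axis j 1 $ i) (at 0)"
    by simp
  from DERIV_mult[OF this has_partial_bump_power[OF assms, of q x j]]
  show ?thesis
    by (rule DERIV_cong) (simp add: axis_def mult_ac)
qed

lemma partial_xI:
  assumes "((\<lambda>h. f (x + h *\<^sub>R axis i 1)) has_real_derivative d) (at 0)"
  shows "has_partial_x i f x" "partial_x i f x = d"
  using assms unfolding has_partial_x_def partial_x_def
  by (auto intro: DERIV_imp_deriv simp: real_differentiable_def)

lemma profile_bump_eq:
  "profile m M B (bump q x) \<tau> =
     (tprof (m + 1) M \<tau> + B * tprof m M \<tau>) * bump q x ^ 3 - B * tprof m M \<tau> * bump q x ^ 4"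
  by (simp add: profile_def algebra_simps)

lemma partial_test_phi:
  fixes x :: "real^'n"
  shows "has_partial_x i (\<lambda>y. test_phi m M B q T y t) x"
    and "partial_x i (\<lambda>y. test_phi m M B q T y t) x =
      (tprof (m + 1) M (1 - t / T) + B * tprof m M (1 - t / T)) * (- (6 / q)) * (x $ i * bump q x ^ 2)
      + B * tprof m M (1 - t / T) * (8 / q) * (x $ i * bump q x ^ 3)"
proof -
  let ?a = "tprof (m + 1) M (1 - t / T) + B * tprof m M (1 - t / T)"
  let ?b = "B * tprof m M (1 - t / T)"
  have "((\<lambda>h. test_phi m M B q T (x + h *\<^sub>R axis i 1) t) has_real_derivative
     ?a * (- (6 / q)) * (x $ i * bump q x ^ 2) + ?b * (8 / q) * (x $ i * bump q x ^ 3)) (at 0)"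
    unfolding test_phi_def profile_bump_eq
    by (rule DERIV_cong[OF DERIV_diff[OF DERIV_cmult[OF has_partial_bump_power[of 3 q x i], of ?a]
        DERIV_cmult[OF has_partial_bump_power[of 4 q x i], of ?b]]]) (simp_all add: algebra_simps)
  note partial_xI[OF this]
  then show "has_partial_x i (\<lambda>y. test_phi m M B q T y t) x"
    and "partial_x i (\<lambda>y. test_phi m M B q T y t) x =
       ?a * (- (6 / q)) * (x $ i * bump q x ^ 2) + ?b * (8 / q) * (x $ i * bump q x ^ 3)" by blast+
qed

lemma partial_partial_test_phi:
  fixes x :: "real^'n"
  shows "has_partial_x j (partial_x i (\<lambda>y. test_phi m M B q T y t)) x"
    and "partial_x j (partial_x i (\<lambda>y. test_phi m M B q T y t)) x =
      (tprof (m + 1) M (1 - t / T) + B * tprof m M (1 - t / T)) * (- (6 / q)) *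
        ((if i = j then bump q x ^ 2 else 0) - (4 / q) * (x $ i * (x $ j * bump q x)))
      + B * tprof m M (1 - t / T) * (8 / q) *
        ((if i = j then bump q x ^ 3 else 0) - (6 / q) * (x $ i * (x $ j * bump q x ^ 2)))"
proof -
  let ?a = "(tprof (m + 1) M (1 - t / T) + B * tprof m M (1 - t / T)) * (- (6 / q))"
  let ?b = "B * tprof m M (1 - t / T) * (8 / q)"
  have "((\<lambda>h. partial_x i (\<lambda>y. test_phi m M B q T y t) (x + h *\<^sub>R axis j 1)) has_real_derivative
     ?a * ((if i = j then bump q x ^ 2 else 0) - (4 / q) * (x $ i * (x $ j * bump q x)))
      + ?b * ((if i = j then bump q x ^ 3 else 0) - (6 / q) * (x $ i * (x $ j * bump q x ^ 2)))) (at 0)"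
    unfolding partial_test_phi(2)
    by (rule DERIV_cong[OF DERIV_add[OF DERIV_cmult[OF has_partial_nth_bump_power[of 2 x j i q], of ?a]
        DERIV_cmult[OF has_partial_nth_bump_power[of 3 x j i q], of ?b]]]) simp_all
  note partial_xI[OF this]
  then show "has_partial_x j (partial_x i (\<lambda>y. test_phi m M B q T y t)) x"
    and "partial_x j (partial_x i (\<lambda>y. test_phi m M B q T y t)) x =
     ?a * ((if i = j then bump q x ^ 2 else 0) - (4 / q) * (x $ i * (x $ j * bump q x)))
      + ?b * ((if i = j then bump q x ^ 3 else 0) - (6 / q) * (x $ i * (x $ j * bump q x ^ 2)))" by blast+
qed

lemma laplacian_test_phi:
  fixes x :: "real^'n"
  assumes "0 < q"
  shows "laplacian (\<lambda>y. test_phi m M B q T y t) x =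
     lap0 (real CARD('n)) (bump q x) / q * tprof (m + 1) M (1 - t / T)
     + B * lap1 (real CARD('n)) (bump q x) / q * tprof m M (1 - t / T)"
proof -
  let ?N = "real CARD('n)" and ?y = "bump q x"
  let ?a = "(tprof (m + 1) M (1 - t / T) + B * tprof m M (1 - t / T)) * (- (6 / q))"
  let ?b = "B * tprof m M (1 - t / T) * (8 / q)"
  have sq: "(\<Sum>i\<in>UNIV. x $ i * (x $ i * c)) = (norm x)\<^sup>2 * c" for c
    by (simp add: power2_norm_eq_inner inner_vec_def sum_distrib_right mult.assoc)
  \<comment> \<open>Off the support both sides vanish, so the formula for the Laplacian needs no
    case distinction.\<close>
  have s: "(norm x)\<^sup>2 * ?y = q * (1 - ?y) * ?y"
    using assms by (auto simp: bump_def max_def field_simps)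
  have s2: "(norm x)\<^sup>2 * ?y ^ 2 = q * (1 - ?y) * ?y ^ 2"
    using s by (simp add: power2_eq_square)
  have "laplacian (\<lambda>y. test_phi m M B q T y t) x =
      ?a * (?N * ?y ^ 2 - (4 / q) * ((norm x)\<^sup>2 * ?y))
      + ?b * (?N * ?y ^ 3 - (6 / q) * ((norm x)\<^sup>2 * ?y ^ 2))"
    unfolding laplacian_def partial_partial_test_phi(2)
    by (simp add: sum.distrib sum_subtractf sum_distrib_left[symmetric] sum_divide_distrib[symmetric] sq)
  also have "\<dots> = lap0 ?N ?y / q * tprof (m + 1) M (1 - t / T)
     + B * lap1 ?N ?y / q * tprof m M (1 - t / T)"
    unfolding s s2 lap0_def lap1_def using assms by (simp add: field_simps)
  finally show ?thesis .
qed

section \<open>Regularity of the test function\<close>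

lemma continuous_on_bump [continuous_intros]:
  "continuous_on S f \<Longrightarrow> continuous_on S (\<lambda>z. bump q (f z))"
  unfolding bump_def divide_inverse by (intro continuous_intros)

lemma continuous_on_tprof [continuous_intros]:
  "continuous_on S f \<Longrightarrow> continuous_on S (\<lambda>z. tprof m M (f z))"
  unfolding tprof_def by (intro continuous_intros)

lemma continuous_on_tprof_rate [continuous_intros]:
  "continuous_on S f \<Longrightarrow> continuous_on S (\<lambda>z. tprof_rate m M (f z))"
  unfolding tprof_rate_def by (intro continuous_intros)

text \<open>Both the test function and its Laplacian have this separated form, so the lemma serves
  twice.\<close>

lemma C1_time_separated:
  fixes a b :: "real^'n \<Rightarrow> real"
  assumes T: "0 < T" and a: "continuous_on UNIV a" and b: "continuous_on UNIV b"
  shows "C1_time T (\<lambda>x t. a x * tprof (m + 1) M (1 - t / T) + b x * tprof m M (1 - t / T))"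
proof -
  have D: "((\<lambda>t. a x * tprof (m + 1) M (1 - t / T) + b x * tprof m M (1 - t / T)) has_real_derivative
     a x * (tprof_rate (m + 1) M (1 - t / T) / T) + b x * (tprof_rate m M (1 - t / T) / T)) (at t within S)" for x t S
    using T by (intro DERIV_add DERIV_cmult tprof_deriv) auto
  have V: "vector_derivative (\<lambda>t. a x * tprof (m + 1) M (1 - t / T) + b x * tprof m M (1 - t / T)) (at t within {0..T})
     = a x * (tprof_rate (m + 1) M (1 - t / T) / T) + b x * (tprof_rate m M (1 - t / T) / T)"
    if "t \<in> {0..T}" for x t
    using D[of x t "{0..T}"] that T unfolding has_real_derivative_iff_has_vector_derivative
    by (intro vector_derivative_within_cbox[of 0 T, unfolded cbox_interval]) auto
  have a': "continuous_on S (\<lambda>z. a (f z))" if "continuous_on S f" for S :: "('x::topological_space) set" and f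
    using continuous_on_compose2[OF a that] by simp
  have b': "continuous_on S (\<lambda>z. b (f z))" if "continuous_on S f" for S :: "('x::topological_space) set" and f
    using continuous_on_compose2[OF b that] by simp
  have "continuous_on (UNIV \<times> {0..T}) (\<lambda>z. a (fst z) * (tprof_rate (m + 1) M (1 - snd z / T) / T)
     + b (fst z) * (tprof_rate m M (1 - snd z / T) / T))"
    unfolding divide_inverse by (intro continuous_intros a' b')
  then have "continuous_on (UNIV \<times> {0..T}) (\<lambda>(x, t). vector_derivative
     (\<lambda>t. a x * tprof (m + 1) M (1 - t / T) + b x * tprof m M (1 - t / T)) (at t within {0..T}))"
  proof (rule continuous_on_eq)
    fix z :: "(real^'n) \<times> real" assume "z \<in> UNIV \<times> {0..T}"
    then show "a (fst z) * (tprof_rate (m + 1) M (1 - snd z / T) / T)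
     + b (fst z) * (tprof_rate m M (1 - snd z / T) / T) = (case z of (x, t) \<Rightarrow> vector_derivative
     (\<lambda>t. a x * tprof (m + 1) M (1 - t / T) + b x * tprof m M (1 - t / T)) (at t within {0..T}))"
      using V[of "snd z" "fst z"] by (auto simp: case_prod_unfold)
  qed
  then show ?thesis
    unfolding C1_time_def using D by (auto simp: real_differentiable_def)
qed

lemma test_phi_eq:
  "test_phi m M B q T x t =
    bump q x ^ 3 * tprof (m + 1) M (1 - t / T) + B * (bump q x ^ 3 - bump q x ^ 4) * tprof m M (1 - t / T)"
  by (simp add: test_phi_def profile_def)

lemma test_function_test_phi:
  assumes m: "0 < m" and q: "0 < q" and T: "0 < T"
  shows "test_function T (test_phi m M B q T :: real^'n \<Rightarrow> real \<Rightarrow> real)"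
  unfolding test_function_def
proof (intro conjI allI)
  have "C1_time T (\<lambda>(x::real^'n) t. bump q x ^ 3 * tprof (m + 1) M (1 - t / T)
      + B * (bump q x ^ 3 - bump q x ^ 4) * tprof m M (1 - t / T))"
    by (intro C1_time_separated T continuous_intros)
  then have "C1_time T (test_phi m M B q T :: real^'n \<Rightarrow> real \<Rightarrow> real)"
    unfolding test_phi_eq[abs_def] .
  moreover have "continuous_on (UNIV \<times> {0..T}) (\<lambda>(x::real^'n, t). test_phi m M B q T x t)"
    unfolding test_phi_eq case_prod_unfold divide_inverse by (intro continuous_intros)
  moreover have "continuous_on (UNIV \<times> {0..T}) (\<lambda>(x::real^'n, t). partial_x i (\<lambda>y. test_phi m M B q T y t) x)" for i
    unfolding partial_test_phi(2) case_prod_unfold divide_inverse by (intro continuous_intros)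
  moreover have "continuous_on (UNIV \<times> {0..T}) (\<lambda>(x::real^'n, t). partial_x j (partial_x i (\<lambda>y. test_phi m M B q T y t)) x)" for i j
    unfolding partial_partial_test_phi(2) case_prod_unfold divide_inverse
    by (cases "i = j") (auto intro!: continuous_intros)
  ultimately show "C21 T (test_phi m M B q T :: real^'n \<Rightarrow> real \<Rightarrow> real)"
    unfolding C21_def using partial_test_phi(1) partial_partial_test_phi(1) by blast
  show "C1_time T (\<lambda>(x::real^'n) t. laplacian (\<lambda>y. test_phi m M B q T y t) x)"
    unfolding laplacian_test_phi[OF q] lap0_def lap1_def divide_inverse[of _ q]
    by (intro C1_time_separated T continuous_intros)
  have "bump q x = 0" if "x \<notin> cball 0 (sqrt q)" for x :: "real^'n"
  proof -
    have "q \<le> (norm x)\<^sup>2" using that q by (metis less_imp_le mem_cball_0 not_le real_sqrt_le_iff real_sqrt_pow2 power_mono real_sqrt_ge_zero)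
    then show ?thesis using q by (simp add: bump_def)
  qed
  then show "\<exists>K. compact K \<and> (\<forall>(x::real^'n) t. x \<notin> K \<and> t \<in> {0..T} \<longrightarrow> test_phi m M B q T x t = 0)"
    by (intro exI[of _ "cball 0 (sqrt q)"]) (auto simp: test_phi_eq)
  \<comment> \<open>At the terminal time \<tau> is 0, and both profiles carry a positive power of
    \<tau>.\<close>
  show "test_phi m M B q T x T = 0" for x :: "real^'n"
    using m T by (simp add: test_phi_eq tprof_def)
qed

text \<open>This is the scaling of the equation: the Laplacian contributes \<open>1 / q\<close> and
  the Caputo derivative \<open>T powr (\<alpha> - 1)\<close>, so with this \<open>q\<close> both
  terms are of order \<open>1 / T\<close>.\<close>

lemma test_phi_operator:
  fixes x :: "real^'n"
  assumes \<alpha>: "0 < \<alpha>" and m: "0 < m" and \<Lambda>: "0 < \<Lambda>" and T: "0 < T" and t: "t < T"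
  defines "q \<equiv> \<Lambda> * T powr \<alpha>"
  shows "deriv (test_phi m M B q T x) t + caputo_right \<alpha> T (\<lambda>s. laplacian (\<lambda>y. test_phi m M B q T y s) x) t
    = defect \<alpha> (real CARD('n)) m M B \<Lambda> (bump q x) (1 - t / T) / T"
proof -
  have q: "0 < q" using \<Lambda> T by (simp add: q_def)
  let ?y = "bump q x" and ?N = "real CARD('n)"
  have "((\<lambda>t. ?y ^ 3 * tprof (m + 1) M (1 - t / T) + B * (?y ^ 3 - ?y ^ 4) * tprof m M (1 - t / T)) has_real_derivative
     ?y ^ 3 * (tprof_rate (m + 1) M (1 - t / T) / T) + B * (?y ^ 3 - ?y ^ 4) * (tprof_rate m M (1 - t / T) / T)) (at t)"
    using T by (intro DERIV_add DERIV_cmult tprof_deriv) auto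
  then have 1: "deriv (test_phi m M B q T x) t =
     ?y ^ 3 * (tprof_rate (m + 1) M (1 - t / T) / T) + B * (?y ^ 3 - ?y ^ 4) * (tprof_rate m M (1 - t / T) / T)"
    unfolding test_phi_eq[abs_def] by (rule DERIV_imp_deriv)
  have "T powr (\<alpha> - 1) / q = 1 / (\<Lambda> * T)"
    using T \<Lambda> by (simp add: q_def powr_diff)
  then have 2: "T powr (\<alpha> - 1) * (a / q * c + B * b / q * d) = (a * c + B * b * d) / \<Lambda> / T" for a b c d
  proof -
    have "T powr (\<alpha> - 1) * (a / q * c + B * b / q * d) = T powr (\<alpha> - 1) / q * (a * c + B * b * d)"
      by (simp add: algebra_simps add_divide_distrib)
    also have "\<dots> = (a * c + B * b * d) / \<Lambda> / T"
      unfolding \<open>T powr (\<alpha> - 1) / q = 1 / (\<Lambda> * T)\<close> by simp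
    finally show ?thesis .
  qed
  show ?thesis
    unfolding 1 laplacian_test_phi[OF q] caputo_right_tprof[OF \<alpha> m t T] 2 defect_def
    by (simp add: add_divide_distrib)
qed

section \<open>The energy inequality\<close>

text \<open>A form of Young's inequality. At the threshold \<open>K powr (- (p / (p - 1)))\<close>
  the values of \<open>A powr (1 / p)\<close> and \<open>K * A\<close> agree; below it the constant
  dominates, above it the linear term.\<close>

lemma powr_inverse_le_linear:
  fixes A K p :: real
  assumes "0 \<le> A" "0 < K" "1 < p"
  shows "A powr (1 / p) \<le> K * A + K powr (- (1 / (p - 1)))"
proof (cases "A \<le> K powr (- (p / (p - 1)))")
  case True
  have "A powr (1 / p) \<le> (K powr (- (p / (p - 1)))) powr (1 / p)"
    using assms True by (intro powr_mono2) auto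
  also have "\<dots> = K powr (- (1 / (p - 1)))"
    using assms by (simp add: powr_powr)
  finally show ?thesis using assms by (simp add: add_increasing)
next
  case False
  then have A: "K powr (- (p / (p - 1))) < A" by simp
  then have A0: "0 < A" using assms by (meson le_less_trans powr_ge_zero)
  have "A powr (1 / p) = A powr 1 * A powr (- ((p - 1) / p))"
    using assms A0 by (subst powr_add[symmetric]) (simp add: field_simps)
  also have "A powr (- ((p - 1) / p)) \<le> (K powr (- (p / (p - 1)))) powr (- ((p - 1) / p))"
    using assms A by (intro powr_mono2') auto
  also have "\<dots> = K" using assms by (simp add: powr_powr)
  finally show ?thesis
    using assms A0 by (simp add: mult.commute add_increasing2 mult_left_mono)
qed

lemma bump_bounds: "0 < q \<Longrightarrow> 0 \<le> bump q x" "0 < q \<Longrightarrow> bump q x \<le> 1"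
  by (auto simp: bump_def)

lemma defect_0: "defect \<alpha> N m M B \<Lambda> 0 \<tau> = 0"
  by (simp add: defect_def lap0_def lap1_def)

text \<open>Only the growth in \<open>r\<close> and \<open>T\<close> matters, so an enclosing box
  suffices.\<close>

lemma measure_parabolic_cylinder:
  fixes r T :: real
  assumes r: "0 \<le> r" and T: "0 \<le> T"
  defines "E \<equiv> {z :: (real^'n) \<times> real. norm (fst z) \<le> r \<and> 0 \<le> snd z \<and> snd z \<le> T}"
  shows "E \<in> lmeasurable" and "measure lebesgue E \<le> (2 * r) ^ CARD('n) * T"
proof -
  let ?C = "cbox ((\<chi> i. - r) :: real^'n, 0) ((\<chi> i. r), T)"
  have "E = cball 0 r \<times> {0..T}" by (auto simp: E_def)
  then show m: "E \<in> lmeasurable" by (simp add: lmeasurable_compact compact_Times)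
  have "E \<subseteq> ?C"
  proof
    fix z assume z: "z \<in> E"
    have "\<bar>fst z $ i\<bar> \<le> r" for i
      using component_le_norm_cart[of "fst z" i] z by (simp add: E_def)
    then show "z \<in> ?C"
      using z by (auto simp: E_def cbox_Pair_eq mem_box_cart abs_le_iff mem_Times_iff minus_le_iff)
  qed
  then have "measure lebesgue E \<le> measure lebesgue ?C"
    using m by (intro measure_mono_fmeasurable) auto
  also have "\<dots> = measure lborel (cbox ((\<chi> i. - r) :: real^'n) (\<chi> i. r)) * T"
    using T by (simp add: content_Pair)
  also have "measure lborel (cbox ((\<chi> i. - r) :: real^'n) (\<chi> i. r)) = (2 * r) ^ CARD('n)"
    using r by (subst content_cbox_cart) (auto simp: interval_ne_empty_cart)
  finally show "measure lebesgue E \<le> (2 * r) ^ CARD('n) * T" .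
qed

text \<open>Fatou's lemma, with a bound that need only hold eventually.\<close>

lemma nn_integral_limit_le:
  fixes h :: "nat \<Rightarrow> 'a \<Rightarrow> real"
  assumes h: "\<And>n. integrable M (h n)" "\<And>n. AE z in M. 0 \<le> h n z"
    and lim: "\<And>z. (\<lambda>n. h n z) \<longlonglongrightarrow> g z"
    and c: "\<forall>\<^sub>F n in sequentially. integral\<^sup>L M (h n) \<le> c"
  shows "(\<integral>\<^sup>+z. ennreal (g z) \<partial>M) \<le> ennreal c"
proof -
  have "(\<integral>\<^sup>+z. ennreal (g z) \<partial>M) = (\<integral>\<^sup>+z. liminf (\<lambda>n. ennreal (h n z)) \<partial>M)"
    using lim by (intro nn_integral_cong) (auto intro!: lim_imp_Liminf[symmetric] tendsto_ennrealI)
  also have "\<dots> \<le> liminf (\<lambda>n. \<integral>\<^sup>+z. ennreal (h n z) \<partial>M)"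
    using h by (intro nn_integral_liminf) auto
  also have "\<dots> = liminf (\<lambda>n. ennreal (integral\<^sup>L M (h n)))"
    using h by (simp add: nn_integral_eq_integral)
  also have "\<dots> \<le> limsup (\<lambda>n. ennreal (integral\<^sup>L M (h n)))"
    by (simp add: Liminf_le_Limsup)
  also have "\<dots> \<le> ennreal c"
    using c by (intro Limsup_bounded) (auto elim!: eventually_mono intro: ennreal_leI)
  finally show ?thesis .
qed

text \<open>Both \<open>y\<close> and \<tau> tend to 1, where the main part equals 1 and the
  correction vanishes.\<close>

lemma test_phi_tendsto_1:
  fixes x :: "real^'n"
  assumes "0 < \<alpha>" "0 < \<Lambda>"
  shows "(\<lambda>n. test_phi m M B (\<Lambda> * real (Suc n) powr \<alpha>) (real (Suc n)) x t) \<longlonglongrightarrow> 1"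
proof -
  have n: "filterlim (\<lambda>n. real (Suc n)) at_top sequentially"
    using filterlim_compose[OF filterlim_real_sequentially filterlim_Suc] .
  have "filterlim (\<lambda>n. exp (\<alpha> * ln (real (Suc n)))) at_top sequentially"
    using assms by (intro filterlim_compose[OF exp_at_top] filterlim_tendsto_pos_mult_at_top[OF tendsto_const]
        filterlim_compose[OF ln_at_top] n)
  then have "filterlim (\<lambda>n. real (Suc n) powr \<alpha>) at_top sequentially"
    by (simp add: powr_def)
  then have "filterlim (\<lambda>n. \<Lambda> * real (Suc n) powr \<alpha>) at_top sequentially"
    using assms by (intro filterlim_tendsto_pos_mult_at_top[OF tendsto_const])
  then have "(\<lambda>n. (norm x)\<^sup>2 / (\<Lambda> * real (Suc n) powr \<alpha>)) \<longlonglongrightarrow> 0"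
    by (intro real_tendsto_divide_at_top[OF tendsto_const])
  then have y: "(\<lambda>n. bump (\<Lambda> * real (Suc n) powr \<alpha>) x) \<longlonglongrightarrow> max 0 (1 - 0)"
    unfolding bump_def by (intro tendsto_intros)
  have t: "(\<lambda>n. 1 - t / real (Suc n)) \<longlonglongrightarrow> 1 - 0"
    by (intro tendsto_intros real_tendsto_divide_at_top[OF tendsto_const n])
  have "(\<lambda>n. test_phi m M B (\<Lambda> * real (Suc n) powr \<alpha>) (real (Suc n)) x t) \<longlonglongrightarrow>
     max 0 (1 - 0) ^ 3 * ((1 + M) * (1 - 0) ^ (m + 1) - M * (1 - 0) ^ (m + 1 + 1))
     + B * (max 0 (1 - 0) ^ 3 - max 0 (1 - 0) ^ 4) * ((1 + M) * (1 - 0) ^ m - M * (1 - 0) ^ (m + 1))"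
    unfolding test_phi_eq tprof_def by (intro tendsto_intros y t)
  then show ?thesis by simp
qed

text \<open>At early times the defect is nonnegative, and outside the ball it vanishes; this is the
  case with bound 0. Elsewhere \<open>far\<close> is followed by Young's inequality.
  \<open>V\<close> is the order of the volume of the parabolic cylinder, so the constant term has an
  integral bounded independently of \<open>T\<close>.\<close>

lemma pointwise_source_bound:
  fixes \<alpha> \<rho> \<sigma> p \<Lambda> \<delta> C M B :: real and m :: nat
  assumes \<alpha>: "0 < \<alpha>" and \<rho>: "0 \<le> \<rho>" and p: "1 < p"
    and crit: "p \<le> 1 + (2 * (\<sigma> + 1) + \<rho> * \<alpha>) / (real CARD('n) * \<alpha>)"
    and MB: "0 < M" "0 < B" and \<Lambda>: "0 < \<Lambda>" and \<delta>: "0 < \<delta>" and C: "0 < C"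
    and near: "\<And>y \<tau>. \<lbrakk>0 \<le> y; y \<le> 1; 0 < \<tau>; \<tau> \<le> 1; 1 - \<delta> \<le> \<tau>\<rbrakk> \<Longrightarrow> 0 \<le> defect \<alpha> (real CARD('n)) m M B \<Lambda> y \<tau>"
    and far: "\<And>y \<tau>. \<lbrakk>0 \<le> y; y \<le> 1; 0 < \<tau>; \<tau> \<le> 1\<rbrakk> \<Longrightarrow>
       - defect \<alpha> (real CARD('n)) m M B \<Lambda> y \<tau> \<le> C * ((1 - y) powr (\<rho> / 2) * profile m M B y \<tau>) powr (1 / p)"
  defines "C3 \<equiv> C * (max 1 (\<delta> powr - \<sigma>) * \<Lambda> powr - (\<rho> / 2)) powr (1 / p)"
  fixes x :: "real^'n" and T t U K :: real
  assumes T: "1 \<le> T" and t: "0 < t" "t < T" and U: "0 \<le> U" and K: "0 < K"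
  defines "q \<equiv> \<Lambda> * T powr \<alpha>" and "V \<equiv> T powr (1 + real CARD('n) * \<alpha> / 2)"
  shows "- (U * (defect \<alpha> (real CARD('n)) m M B \<Lambda> (bump q x) (1 - t / T) / T)) \<le>
    (if \<delta> * T \<le> t \<and> norm x \<le> sqrt q then
       C3 * (K * (norm x powr \<rho> * t powr \<sigma> * U powr p * test_phi m M B q T x t) + K powr (- (1 / (p - 1))) / V)
     else 0)"
proof -
  let ?N = "real CARD('n)" and ?y = "bump q x" and ?\<tau> = "1 - t / T"
  have N: "0 < ?N" by simp
  have q: "0 < q" using \<Lambda> T by (simp add: q_def)
  have y: "0 \<le> ?y" "?y \<le> 1" using bump_bounds[OF q] by auto
  have \<tau>: "0 < ?\<tau>" "?\<tau> \<le> 1" using t by auto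
  have trivial: "- (U * (defect \<alpha> ?N m M B \<Lambda> ?y ?\<tau> / T)) \<le> 0" if "0 \<le> defect \<alpha> ?N m M B \<Lambda> ?y ?\<tau>"
    using that U T by simp
  show ?thesis
  proof (cases "\<delta> * T \<le> t \<and> norm x \<le> sqrt q")
    case False
    have "0 \<le> defect \<alpha> ?N m M B \<Lambda> ?y ?\<tau>"
    proof (cases "\<delta> * T \<le> t")
      case True
      then have "sqrt q \<le> norm x" using False by simp
      then have "q \<le> (norm x)\<^sup>2" using real_sqrt_le_iff[of q "(norm x)\<^sup>2"] by simp
      then have "?y = 0" using q by (simp add: bump_def)
      then show ?thesis by (simp add: defect_0)
    next
      case False
      then have "1 - \<delta> \<le> ?\<tau>" using T by (simp add: field_simps)
      with near y \<tau> show ?thesis by blast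
    qed
    from trivial[OF this] False show ?thesis by auto
  next
    case True
    then have t\<delta>: "\<delta> \<le> t / T" using T by (simp add: field_simps)
    have "(norm x)\<^sup>2 \<le> q" using True real_sqrt_le_iff[of "(norm x)\<^sup>2" q] by simp
    then have s: "1 - ?y = (norm x)\<^sup>2 / q" using q by (simp add: bump_def)
    define P where "P = profile m M B ?y ?\<tau>"
    have P0: "0 \<le> P" unfolding P_def using MB y \<tau> by (intro profile_nonneg) auto
    define h where "h = norm x powr \<rho> * t powr \<sigma> * U powr p * P"
    have h0: "0 \<le> h" using P0 by (simp add: h_def)
    have hphi: "h = norm x powr \<rho> * t powr \<sigma> * U powr p * test_phi m M B q T x t"
      by (simp add: h_def P_def test_phi_def)
    \<comment> \<open>On \<open>\<delta> \<le> t / T < 1\<close> the power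
      \<open>(t / T) powr - \<sigma>\<close> is largest at the left end if \<sigma> is nonnegative
      and is below 1 otherwise.\<close>
    define D where "D = max 1 (\<delta> powr - \<sigma>)"
    have D: "(t / T) powr - \<sigma> \<le> D"
    proof (cases "0 \<le> \<sigma>")
      case True
      then have "(t / T) powr - \<sigma> \<le> \<delta> powr - \<sigma>" using \<delta> t\<delta> by (intro powr_mono2') auto
      then show ?thesis by (simp add: D_def)
    next
      case False
      then have "(t / T) powr - \<sigma> \<le> 1 powr - \<sigma>" using t T by (intro powr_mono2) auto
      then show ?thesis by (simp add: D_def)
    qed
    have sr: "(1 - ?y) powr (\<rho> / 2) = norm x powr \<rho> * \<Lambda> powr - (\<rho> / 2) * T powr - (\<alpha> * \<rho> / 2)"
    proof -
      have "(1 - ?y) powr (\<rho> / 2) = ((norm x)\<^sup>2) powr (\<rho> / 2) / q powr (\<rho> / 2)"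
        unfolding s using q by (simp add: powr_divide)
      also have "((norm x)\<^sup>2) powr (\<rho> / 2) = norm x powr \<rho>"
        by (cases "x = 0") (simp_all add: powr_powr flip: powr_numeral)
      also have "q powr (\<rho> / 2) = \<Lambda> powr (\<rho> / 2) * T powr (\<alpha> * \<rho> / 2)"
        using \<Lambda> T by (simp add: q_def powr_mult powr_powr)
      finally show ?thesis by (simp add: powr_minus_divide)
    qed
    have ts: "(t / T) powr - \<sigma> * t powr \<sigma> = T powr \<sigma>"
      using t T by (simp add: powr_divide powr_minus_divide)
    have "(1 - ?y) powr (\<rho> / 2) * P * U powr p
       = \<Lambda> powr - (\<rho> / 2) * T powr - (\<alpha> * \<rho> / 2) * T powr - \<sigma> * (T powr \<sigma> * (norm x powr \<rho> * U powr p * P))"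
      unfolding sr using T by (simp add: powr_minus_divide)
    also have "\<dots> = \<Lambda> powr - (\<rho> / 2) * T powr - (\<alpha> * \<rho> / 2) * T powr - \<sigma> * ((t / T) powr - \<sigma> * h)"
      unfolding ts[symmetric] h_def by (simp add: mult_ac)
    also have "\<dots> \<le> \<Lambda> powr - (\<rho> / 2) * T powr - (\<alpha> * \<rho> / 2) * T powr - \<sigma> * (D * h)"
      using D h0 by (intro mult_left_mono mult_right_mono) auto
    also have "\<dots> = D * \<Lambda> powr - (\<rho> / 2) * T powr (- (\<alpha> * \<rho> / 2 + \<sigma>)) * h"
    proof -
      have e: "T powr (- (\<alpha> * \<rho> / 2 + \<sigma>)) = T powr - (\<alpha> * \<rho> / 2) * T powr - \<sigma>"
        by (simp add: powr_add[symmetric])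
      show ?thesis unfolding e by (simp only: mult_ac)
    qed
    finally have base: "(1 - ?y) powr (\<rho> / 2) * P * U powr p \<le> D * \<Lambda> powr - (\<rho> / 2) * T powr (- (\<alpha> * \<rho> / 2 + \<sigma>)) * h" .
    have V: "0 < V" using T by (simp add: V_def)
    have "- (U * (defect \<alpha> ?N m M B \<Lambda> ?y ?\<tau> / T)) = U / T * - defect \<alpha> ?N m M B \<Lambda> ?y ?\<tau>" by simp
    also have "\<dots> \<le> U / T * (C * ((1 - ?y) powr (\<rho> / 2) * P) powr (1 / p))"
      using far[OF y \<tau>] U T by (intro mult_left_mono) (auto simp: P_def)
    also have "\<dots> = C / T * ((1 - ?y) powr (\<rho> / 2) * P * U powr p) powr (1 / p)"
      using U p by (simp add: powr_mult powr_powr)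
    also have "\<dots> \<le> C / T * (D * \<Lambda> powr - (\<rho> / 2) * T powr (- (\<alpha> * \<rho> / 2 + \<sigma>)) * h) powr (1 / p)"
      using base C T p P0 by (intro mult_left_mono powr_mono2) auto
    also have "\<dots> = C3 * (T powr (- ((\<alpha> * \<rho> / 2 + \<sigma>) / p) - 1) * h powr (1 / p))"
    proof -
      have "T powr (- ((\<alpha> * \<rho> / 2 + \<sigma>) / p) - 1) = (T powr (- (\<alpha> * \<rho> / 2 + \<sigma>))) powr (1 / p) / T"
        using T by (simp only: powr_diff powr_powr) (simp add: add_divide_distrib diff_divide_distrib)
      then show ?thesis by (simp add: C3_def D_def powr_mult)
    qed
    \<comment> \<open>Young's inequality will be applied to \<open>V * h\<close>, so that a
      prefactor \<open>1 / V\<close> restores \<open>h\<close> in the linear term and normalizes the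
      constant one.\<close>
    also have "h powr (1 / p) = T powr (- ((1 + ?N * \<alpha> / 2) / p)) * (V * h) powr (1 / p)"
    proof -
      have "V powr (1 / p) = T powr ((1 + ?N * \<alpha> / 2) / p)"
        by (simp add: V_def powr_powr)
      then show ?thesis using T by (simp add: powr_mult powr_minus_divide)
    qed
    also have "T powr (- ((\<alpha> * \<rho> / 2 + \<sigma>) / p) - 1) * (T powr (- ((1 + ?N * \<alpha> / 2) / p)) * (V * h) powr (1 / p))
       = T powr (- 1 - (\<alpha> * \<rho> / 2 + \<sigma> + (1 + ?N * \<alpha> / 2)) / p) * (V * h) powr (1 / p)"
    proof -
      have "- 1 - (\<alpha> * \<rho> / 2 + \<sigma> + (1 + ?N * \<alpha> / 2)) / p = (- ((\<alpha> * \<rho> / 2 + \<sigma>) / p) - 1) + - ((1 + ?N * \<alpha> / 2) / p)"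
        by (simp add: add_divide_distrib)
      then show ?thesis by (simp only: powr_add mult.assoc)
    qed
    finally have 1: "- (U * (defect \<alpha> ?N m M B \<Lambda> ?y ?\<tau> / T)) \<le>
      C3 * (T powr (- 1 - (\<alpha> * \<rho> / 2 + \<sigma> + (1 + ?N * \<alpha> / 2)) / p) * (V * h) powr (1 / p))" .
    \<comment> \<open>This is where \<open>p\<close> being at most critical enters: the total
      exponent of \<open>T\<close> is at most that of \<open>1 / V\<close>, and \<open>T\<close> is
      at least 1.\<close>
    have 2: "T powr (- 1 - (\<alpha> * \<rho> / 2 + \<sigma> + (1 + ?N * \<alpha> / 2)) / p) \<le> 1 / V"
    proof -
      have "(p - 1) * (?N * \<alpha>) \<le> 2 * (\<sigma> + 1) + \<rho> * \<alpha>"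
        using crit N \<alpha> by (simp add: pos_le_divide_eq[symmetric])
      then have "p * (?N * \<alpha> / 2) \<le> \<alpha> * \<rho> / 2 + \<sigma> + (1 + ?N * \<alpha> / 2)"
        by (simp add: algebra_simps)
      then have "?N * \<alpha> / 2 \<le> (\<alpha> * \<rho> / 2 + \<sigma> + (1 + ?N * \<alpha> / 2)) / p"
        using p by (simp add: pos_le_divide_eq mult.commute)
      then have "T powr (- 1 - (\<alpha> * \<rho> / 2 + \<sigma> + (1 + ?N * \<alpha> / 2)) / p) \<le> T powr - (1 + ?N * \<alpha> / 2)"
        using T by (intro powr_mono) auto
      then show ?thesis unfolding V_def powr_minus_divide .
    qed
    have 3: "(V * h) powr (1 / p) \<le> K * (V * h) + K powr (- (1 / (p - 1)))"
      using V h0 K p by (intro powr_inverse_le_linear) auto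
    note 1
    also have "C3 * (T powr (- 1 - (\<alpha> * \<rho> / 2 + \<sigma> + (1 + ?N * \<alpha> / 2)) / p) * (V * h) powr (1 / p))
        \<le> C3 * (1 / V * (K * (V * h) + K powr (- (1 / (p - 1)))))"
      using C V by (intro mult_left_mono mult_mono 2 3) (auto simp: C3_def)
    also have "1 / V * (K * (V * h) + K powr (- (1 / (p - 1)))) = K * h + K powr (- (1 / (p - 1))) / V"
      using V by (simp add: field_simps)
    finally have "- (U * (defect \<alpha> ?N m M B \<Lambda> ?y ?\<tau> / T)) \<le> C3 * (K * h + K powr (- (1 / (p - 1))) / V)" .
    then show ?thesis using True by (simp add: hphi)
  qed
qed

section \<open>Integration of the pointwise bound over the slab\<close>

lemma Omega_sets [measurable]: "Omega T \<in> sets lebesgue" "Omega_inf \<in> sets lebesgue"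
proof -
  have "open (Omega T)" "open Omega_inf"
    unfolding Omega_def Omega_inf_def by (auto intro!: open_Times)
  then show "Omega T \<in> sets lebesgue" "Omega_inf \<in> sets lebesgue"
    by (auto intro!: sets_completionI_sets borel_open)
qed

lemma closed_time_ge: "closed {z :: (real^'n) \<times> real. c \<le> snd z}"
  by (intro closed_Collect_le continuous_intros)

text \<open>The weak formulation, tested with \<open>test_phi\<close>, bounds the integral of the
  source by that of minus \<open>u\<close> times the defect, and the pointwise bound is then
  integrated. The constants do not depend on \<open>T\<close>, and \<open>K\<close> stays free for
  two different choices later.\<close>

lemma energy_inequality:
  fixes u0 :: "real^'n \<Rightarrow> real" and u :: "(real^'n) \<times> real \<Rightarrow> real" and \<alpha> \<rho> \<sigma> p \<Lambda> \<delta> C M B :: real and m :: nat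
  assumes \<alpha>: "0 < \<alpha>" and \<rho>: "0 \<le> \<rho>" and p: "1 < p"
    and crit: "p \<le> 1 + (2 * (\<sigma> + 1) + \<rho> * \<alpha>) / (real CARD('n) * \<alpha>)"
    and u0: "\<And>x. 0 \<le> u0 x"
    and sol: "global_weak_solution \<alpha> \<rho> \<sigma> p u0 u"
    and u: "AE z in lebesgue. z \<in> Omega_inf \<longrightarrow> 0 \<le> u z"
    and m: "0 < m" and MB: "0 < M" "0 < B" and \<Lambda>: "0 < \<Lambda>" and \<delta>: "0 < \<delta>" and C: "0 < C"
    and near: "\<And>y \<tau>. \<lbrakk>0 \<le> y; y \<le> 1; 0 < \<tau>; \<tau> \<le> 1; 1 - \<delta> \<le> \<tau>\<rbrakk> \<Longrightarrow> 0 \<le> defect \<alpha> (real CARD('n)) m M B \<Lambda> y \<tau>"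
    and far: "\<And>y \<tau>. \<lbrakk>0 \<le> y; y \<le> 1; 0 < \<tau>; \<tau> \<le> 1\<rbrakk> \<Longrightarrow>
       - defect \<alpha> (real CARD('n)) m M B \<Lambda> y \<tau> \<le> C * ((1 - y) powr (\<rho> / 2) * profile m M B y \<tau>) powr (1 / p)"
  defines "C3 \<equiv> C * (max 1 (\<delta> powr - \<sigma>) * \<Lambda> powr - (\<rho> / 2)) powr (1 / p)"
    and "h \<equiv> \<lambda>T z. norm (fst z) powr \<rho> * snd z powr \<sigma> * u z powr p * test_phi m M B (\<Lambda> * T powr \<alpha>) T (fst z) (snd z)"
  assumes T: "1 \<le> T"
  shows "set_integrable lebesgue (Omega T) (h T)"
    and "AE z in lebesgue. z \<in> Omega T \<longrightarrow> 0 \<le> h T z"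
    and "\<And>K. 0 < K \<Longrightarrow> (LINT z:Omega T|lebesgue. h T z) \<le>
      C3 * (K * (LINT z:Omega T \<inter> {z. \<delta> * T \<le> snd z}|lebesgue. h T z)
        + K powr (- (1 / (p - 1))) * (2 * sqrt \<Lambda>) ^ CARD('n))"
proof -
  define q where "q = \<Lambda> * T powr \<alpha>"
  have T0: "0 < T" using T by simp
  have q: "0 < q" using \<Lambda> T0 by (simp add: q_def)
  let ?\<phi> = "test_phi m M B q T :: real^'n \<Rightarrow> real \<Rightarrow> real"
  let ?D = "\<lambda>x t. caputo_right \<alpha> T (\<lambda>s. laplacian (\<lambda>y. ?\<phi> y s) x) t"
  have tf: "test_function T ?\<phi>" by (rule test_function_test_phi[OF m q T0])
  note weak = sol[unfolded global_weak_solution_def, THEN conjunct2, rule_format, OF T0 tf]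
  note i1 = weak[THEN conjunct2, THEN conjunct1]
  note i2 = weak[THEN conjunct2, THEN conjunct2, THEN conjunct1]
  note i3 = weak[THEN conjunct2, THEN conjunct2, THEN conjunct2, THEN conjunct1]
  note eq = weak[THEN conjunct2, THEN conjunct2, THEN conjunct2, THEN conjunct2]
  have hT: "h T = (\<lambda>(x, t). norm x powr \<rho> * t powr \<sigma> * u (x, t) powr p * ?\<phi> x t)"
    by (simp add: h_def q_def case_prod_unfold)
  show ih: "set_integrable lebesgue (Omega T) (h T)" unfolding hT by (rule i1)
  have phi0: "0 \<le> ?\<phi> x t" if "0 \<le> t" "t \<le> T" for x t
    unfolding test_phi_def using MB bump_bounds[OF q, of x] that T0 by (intro profile_nonneg) auto
  have h0: "0 \<le> h T z" if "z \<in> Omega T" for z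
    using that phi0[of "snd z" "fst z"] by (auto simp: h_def q_def[symmetric] Omega_def)
  then show "AE z in lebesgue. z \<in> Omega T \<longrightarrow> 0 \<le> h T z" by simp
  let ?\<Phi> = "\<lambda>z. u z * (defect \<alpha> (real CARD('n)) m M B \<Lambda> (bump q (fst z)) (1 - snd z / T) / T)"
  have op: "(case z of (x, t) \<Rightarrow> u (x, t) * ?D x t) + (case z of (x, t) \<Rightarrow> u (x, t) * deriv (?\<phi> x) t) = ?\<Phi> z"
    if "z \<in> Omega T" for z
  proof -
    have "snd z < T" using that by (auto simp: Omega_def)
    note test_phi_operator[OF \<alpha> m \<Lambda> T0 this, of M B "fst z", folded q_def, symmetric]
    then show ?thesis
      unfolding case_prod_unfold prod.collapse distrib_left[symmetric] by (simp only: add.commute)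
  qed
  have i\<Phi>: "set_integrable lebesgue (Omega T) ?\<Phi>"
    using set_integral_add(1)[OF i2 i3] by (rule set_integrable_cong[THEN iffD1, rotated -1]) (auto simp: op)
  have "(LINT (x, t):Omega T|lebesgue. u (x, t) * ?D x t)
        + (LINT (x, t):Omega T|lebesgue. u (x, t) * deriv (?\<phi> x) t) = (LINT z:Omega T|lebesgue. ?\<Phi> z)"
    unfolding set_integral_add(2)[OF i2 i3, symmetric]
    by (intro set_lebesgue_integral_cong) (auto simp: op)
  \<comment> \<open>The initial datum contributes with a favourable sign and is dropped.\<close>
  moreover have "0 \<le> (LINT x|lebesgue. u0 x * ?\<phi> x 0)"
    using u0 phi0 T0 by (intro integral_nonneg_AE) (auto intro!: mult_nonneg_nonneg)
  ultimately have X: "(LINT z:Omega T|lebesgue. h T z) \<le> (LINT z|lebesgue. - (indicator (Omega T) z * ?\<Phi> z))"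
    using eq unfolding hT by (simp add: set_lebesgue_integral_def)
  fix K :: real assume K: "0 < K"
  define k where "k = K powr (- (1 / (p - 1)))"
  define V where "V = T powr (1 + real CARD('n) * \<alpha> / 2)"
  have V: "0 < V" using T0 by (simp add: V_def)
  define A :: "((real^'n) \<times> real) set" where "A = {z. \<delta> * T \<le> snd z}"
  define E :: "((real^'n) \<times> real) set" where "E = {z. norm (fst z) \<le> sqrt q \<and> 0 \<le> snd z \<and> snd z \<le> T}"
  have C3: "0 < C3" using C \<Lambda> by (auto simp: C3_def intro!: mult_pos_pos)
  note E = measure_parabolic_cylinder[of "sqrt q" T, where 'n='n, folded E_def]
  have mE: "E \<in> lmeasurable" "measure lebesgue E \<le> (2 * sqrt q) ^ CARD('n) * T"
    using E q T0 by auto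
  have A: "A \<in> sets lebesgue" unfolding A_def using closed_time_ge[of "\<delta> * T"] by (auto intro!: sets_completionI_sets borel_closed)
  have iA: "set_integrable lebesgue (Omega T \<inter> A) (h T)"
    by (rule set_integrable_subset[OF ih]) (use A in auto)
  let ?G = "\<lambda>z. C3 * K * (indicator (Omega T \<inter> A) z * h T z) + C3 * k / V * indicator E z"
  have iE: "integrable lebesgue (indicator E :: _ \<Rightarrow> real)"
    using mE(1) by (simp only: lmeasurable_iff_integrable)
  have iG: "integrable lebesgue ?G"
    using iA iE unfolding set_integrable_def by (intro Bochner_Integration.integrable_add integrable_mult_right) auto
  have "(LINT z|lebesgue. - (indicator (Omega T) z * ?\<Phi> z)) \<le> (LINT z|lebesgue. ?G z)"
  proof (rule integral_mono_AE)
    show "integrable lebesgue (\<lambda>z. - (indicator (Omega T) z * ?\<Phi> z))"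
      using i\<Phi> unfolding set_integrable_def by simp
    show "AE z in lebesgue. - (indicator (Omega T) z * ?\<Phi> z) \<le> ?G z"
      using u
    proof eventually_elim
      case (elim z)
      show ?case
      proof (cases "z \<in> Omega T")
        case False
        then show ?thesis using C3 V by (simp add: k_def)
      next
        case True
        then have z: "0 < snd z" "snd z < T" "z \<in> Omega_inf" by (auto simp: Omega_def Omega_inf_def)
        with elim have "0 \<le> u z" by simp
        from pointwise_source_bound[OF \<alpha> \<rho> p crit MB \<Lambda> \<delta> C near far T z(1,2) this K, of "fst z"]
        have "- ?\<Phi> z \<le> (if \<delta> * T \<le> snd z \<and> norm (fst z) \<le> sqrt q then C3 * (K * h T z + k / V) else 0)"
          unfolding C3_def q_def k_def V_def h_def prod.collapse .
        also have "\<dots> \<le> C3 * K * (indicator A z * h T z) + C3 * k / V * indicator E z"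
          using C3 K V h0[OF True] z by (auto simp: A_def E_def k_def algebra_simps indicator_def)
        finally show ?thesis using True by (simp add: indicator_inter_arith)
      qed
    qed
  qed (rule iG)
  also have "(LINT z|lebesgue. ?G z) = C3 * K * (LINT z:Omega T \<inter> A|lebesgue. h T z) + C3 * k / V * measure lebesgue E"
    using iA iE unfolding set_integrable_def set_lebesgue_integral_def
    by (subst Bochner_Integration.integral_add) auto
  \<comment> \<open>The radius \<open>sqrt q\<close> is of order
    \<open>T powr (\<alpha> / 2)\<close>, so the cylinder has measure at most a constant times
    \<open>V\<close>, which cancels \<open>1 / V\<close>.\<close>
  also have "\<dots> \<le> C3 * K * (LINT z:Omega T \<inter> A|lebesgue. h T z) + C3 * k / V * ((2 * sqrt \<Lambda>) ^ CARD('n) * V)"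
  proof -
    have "sqrt q = sqrt \<Lambda> * T powr (\<alpha> / 2)"
      unfolding q_def real_sqrt_mult using T0 by (simp add: powr_half_sqrt[symmetric] powr_powr)
    then have "(2 * sqrt q) ^ CARD('n) * T = (2 * sqrt \<Lambda>) ^ CARD('n) * ((T powr (\<alpha> / 2)) ^ CARD('n) * T)"
      by (simp add: power_mult_distrib)
    also have "(T powr (\<alpha> / 2)) ^ CARD('n) * T = V"
      using T0 unfolding V_def by (simp add: powr_add powr_powr powr_realpow[symmetric] mult.commute)
    finally have "measure lebesgue E \<le> (2 * sqrt \<Lambda>) ^ CARD('n) * V" using mE(2) by (simp only:)
    then show ?thesis using C3 V by (intro add_left_mono mult_left_mono) (auto simp: k_def)
  qed
  also have "\<dots> = C3 * (K * (LINT z:Omega T \<inter> A|lebesgue. h T z) + k * (2 * sqrt \<Lambda>) ^ CARD('n))"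
    using V by (simp add: algebra_simps)
  finally show "(LINT z:Omega T|lebesgue. h T z) \<le>
      C3 * (K * (LINT z:Omega T \<inter> {z. \<delta> * T \<le> snd z}|lebesgue. h T z)
        + K powr (- (1 / (p - 1))) * (2 * sqrt \<Lambda>) ^ CARD('n))"
    using X by (simp add: A_def k_def)
qed

section \<open>Nonexistence\<close>

text \<open>Where \<open>x = 0\<close> the weight vanishes and the source says nothing about
  \<open>u\<close>; this set lies in a coordinate hyperplane and is null.\<close>

lemma AE_fst_nonzero: "AE z in lebesgue. fst (z :: (real^'n) \<times> real) \<noteq> 0"
proof -
  fix i :: 'n
  have "negligible {z :: (real^'n) \<times> real. z \<bullet> (axis i 1, 0) = 0}"
    by (intro negligible_standard_hyperplane) (auto simp: Basis_prod_def axis_in_Basis_iff)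
  then have "AE z in lebesgue. z \<notin> {z :: (real^'n) \<times> real. z \<bullet> (axis i 1, 0) = 0}"
    unfolding negligible_iff_null_sets by (rule AE_not_in)
  then show ?thesis
    by eventually_elim (auto simp: inner_prod_def)
qed

theorem theorem3p8:
  fixes \<alpha> \<rho> \<sigma> p :: real
    and u0 :: "real^'n \<Rightarrow> real"
    and u :: "(real^'n) \<times> real \<Rightarrow> real"
  assumes "0 < \<alpha>" and "\<alpha> < 1" and "\<rho> \<ge> 0" and "\<sigma> > -1"
    and "1 < p" and "p \<le> 1 + (2 * (\<sigma> + 1) + \<rho> * \<alpha>) / (real CARD('n) * \<alpha>)"
    and "\<And>x. u0 x \<ge> 0"
    and "global_weak_solution \<alpha> \<rho> \<sigma> p u0 u"
    and "AE z in lebesgue. z \<in> Omega_inf \<longrightarrow> u z \<ge> 0"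
  shows "AE z in lebesgue. z \<in> Omega_inf \<longrightarrow> u z = 0"
proof -
  have N: "0 < real CARD('n)" by simp
  obtain m M B \<Lambda> \<delta> C where par: "0 < m" "0 < M" "0 < B" "0 < \<Lambda>" "0 < \<delta>" "\<delta> < 1" "0 < C"
    and near: "\<And>y \<tau>. \<lbrakk>0 \<le> y; y \<le> 1; 0 < \<tau>; \<tau> \<le> 1; 1 - \<delta> \<le> \<tau>\<rbrakk> \<Longrightarrow> 0 \<le> defect \<alpha> (real CARD('n)) m M B \<Lambda> y \<tau>"
    and far: "\<And>y \<tau>. \<lbrakk>0 \<le> y; y \<le> 1; 0 < \<tau>; \<tau> \<le> 1\<rbrakk> \<Longrightarrow>
       - defect \<alpha> (real CARD('n)) m M B \<Lambda> y \<tau> \<le> C * ((1 - y) powr (\<rho> / 2) * profile m M B y \<tau>) powr (1 / p)"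
    using exists_test_parameters[OF assms(1,2,3,5) N] by blast
  define C3 where "C3 = C * (max 1 (\<delta> powr - \<sigma>) * \<Lambda> powr - (\<rho> / 2)) powr (1 / p)"
  define k0 where "k0 = (2 * sqrt \<Lambda>) ^ CARD('n)"
  define w where "w = (\<lambda>z. norm (fst z) powr \<rho> * snd z powr \<sigma> * u z powr p)"
  define \<phi> where "\<phi> = (\<lambda>T z. test_phi m M B (\<Lambda> * T powr \<alpha>) T (fst z :: real^'n) (snd z))"
  define h where "h = (\<lambda>T z. w z * \<phi> T z)"
  define X where "X = (\<lambda>T. LINT z:Omega T|lebesgue. h T z)"
  define Y where "Y = (\<lambda>T. LINT z:Omega T \<inter> {z. \<delta> * T \<le> snd z}|lebesgue. h T z)"
  have C3: "0 < C3" using par by (auto simp: C3_def intro!: mult_pos_pos)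
  have k0: "0 < k0" using par by (simp add: k0_def)
  have w0: "0 \<le> w z" for z by (simp add: w_def)
  have X_le: "X T \<le> C3 * (K * Y T + K powr (- (1 / (p - 1))) * k0)" if "1 \<le> T" "0 < K" for T K
    using energy_inequality(3)[OF assms(1,3,5,6,7,8,9) par(1,2,3,4,5,7) near far that]
    unfolding X_def Y_def h_def w_def \<phi>_def C3_def k0_def .
  have h_int: "set_integrable lebesgue (Omega T) (h T)" if "1 \<le> T" for T
    using energy_inequality(1)[OF assms(1,3,5,6,7,8,9) par(1,2,3,4,5,7) near far that]
    unfolding h_def w_def \<phi>_def .
  have \<phi>: "0 \<le> \<phi> T z" "\<phi> T z \<le> (1 + B) * (1 + M)" if "1 \<le> T" "z \<in> Omega T" for T z
  proof -
    have "0 < \<Lambda> * T powr \<alpha>" using par that by simp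
    from bump_bounds[OF this] show "0 \<le> \<phi> T z" "\<phi> T z \<le> (1 + B) * (1 + M)"
      using par that unfolding \<phi>_def test_phi_def
      by (auto intro!: profile_nonneg profile_le simp: Omega_def)
  qed
  have h0: "0 \<le> h T z" if "1 \<le> T" "z \<in> Omega T" for T z
    using \<phi>[OF that] w0 by (simp add: h_def)
  have A: "{z. \<delta> * T \<le> snd z} \<in> sets (lebesgue :: ((real^'n) \<times> real) measure)" for T
    using closed_time_ge[of "\<delta> * T"] by (auto intro!: sets_completionI_sets borel_closed)
  have hA_int: "set_integrable lebesgue (Omega T \<inter> {z. \<delta> * T \<le> snd z}) (h T)" if "1 \<le> T" for T
    by (rule set_integrable_subset[OF h_int[OF that]]) (use A in auto)
  have YX: "Y T \<le> X T" if T: "1 \<le> T" for T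
    using h_int[OF T] hA_int[OF T] h0[OF T]
    unfolding X_def Y_def set_lebesgue_integral_def set_integrable_def
    by (intro integral_mono) (auto simp: indicator_def)
  \<comment> \<open>The choice \<open>K = 1 / (2 * C3)\<close> gives \<open>Y T\<close> the
    coefficient 1/2, so it can be absorbed into \<open>X T\<close>.\<close>
  define C5 where "C5 = 2 * C3 * (1 / (2 * C3)) powr (- (1 / (p - 1))) * k0"
  have X_bound: "X T \<le> C5" if T: "1 \<le> T" for T
  proof -
    have "X T \<le> C3 * (1 / (2 * C3) * Y T + (1 / (2 * C3)) powr (- (1 / (p - 1))) * k0)"
      using X_le[OF T, of "1 / (2 * C3)"] C3 by simp
    also have "\<dots> = Y T / 2 + C5 / 2" using C3 by (simp add: C5_def distrib_left)
    finally show ?thesis using YX[OF T] by simp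
  qed

  \<comment> \<open>Integrability of the source on the whole half-space\<close>
  define f where "f = (\<lambda>z. indicator Omega_inf z * w z)"
  \<comment> \<open>Extension by zero from the slab of height \<open>Suc n\<close>, which is at
    least 1 as the energy inequality requires.\<close>
  define H where "H = (\<lambda>n z. indicator (Omega (real (Suc n))) z * h (real (Suc n)) z)"
  have f0: "0 \<le> f z" for z using w0 by (simp add: f_def)
  have H_int: "integrable lebesgue (H n)" for n
    using h_int[of "real (Suc n)"] unfolding set_integrable_def H_def by simp
  have H_eq: "integral\<^sup>L lebesgue (H n) = X (real (Suc n))" for n
    unfolding X_def set_lebesgue_integral_def H_def by simp
  have H0: "0 \<le> H n z" for n z
    using h0[of "real (Suc n)" z] by (cases "z \<in> Omega (real (Suc n))") (auto simp: H_def)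
  have lim: "(\<lambda>n. H n z) \<longlonglongrightarrow> f z" for z
  proof (cases "z \<in> Omega_inf")
    case False
    then have "H n z = f z" for n
      by (auto simp: H_def f_def Omega_def Omega_inf_def indicator_def)
    then show ?thesis by simp
  next
    case True
    have "(\<lambda>n. w z * \<phi> (real (Suc n)) z) \<longlonglongrightarrow> w z * 1"
      unfolding \<phi>_def using assms(1) par by (intro tendsto_intros test_phi_tendsto_1)
    moreover have "\<forall>\<^sub>F n in sequentially. w z * \<phi> (real (Suc n)) z = H n z"
    proof -
      obtain n0 :: nat where "snd z < real n0" using reals_Archimedean2 by blast
      then have "z \<in> Omega (real (Suc n))" if "n0 \<le> n" for n
        using that True by (auto simp: Omega_def Omega_inf_def)
      then show ?thesis
        unfolding eventually_sequentially H_def h_def by (intro exI[of _ n0]) auto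
    qed
    ultimately have "(\<lambda>n. H n z) \<longlonglongrightarrow> w z * 1" by (rule Lim_transform_eventually)
    then show ?thesis using True by (simp add: f_def)
  qed
  \<comment> \<open>Used twice: with \<open>C5\<close> for integrability of \<open>f\<close>, and at
    the end with every positive bound.\<close>
  have nn_le: "(\<integral>\<^sup>+z. ennreal (f z) \<partial>lebesgue) \<le> ennreal c"
    if "\<forall>\<^sub>F n in sequentially. X (real (Suc n)) \<le> c" for c
    by (rule nn_integral_limit_le[OF H_int AE_I2[OF H0] lim]) (use that in \<open>simp only: H_eq\<close>)
  have f_int: "integrable lebesgue f"
  proof (rule integrableI_nonneg)
    show "f \<in> borel_measurable lebesgue"
      by (rule borel_measurable_LIMSEQ_real[OF lim borel_measurable_integrable[OF H_int]])
    have "(\<integral>\<^sup>+z. ennreal (f z) \<partial>lebesgue) \<le> ennreal C5"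
      by (intro nn_le always_eventually allI X_bound) simp
    then show "(\<integral>\<^sup>+z. ennreal (f z) \<partial>lebesgue) < \<infinity>"
      by (simp add: le_less_trans)
  qed (use f0 in auto)

  \<comment> \<open>Decay of the late part of the source\<close>
  define \<psi> where "\<psi> = (\<lambda>n z. indicator {z. \<delta> * real (Suc n) \<le> snd z} z * f z)"
  have \<psi>_int: "integrable lebesgue (\<psi> n)" for n
    using integrable_mult_indicator[OF A f_int] by (simp add: \<psi>_def)
  have "(\<lambda>n. integral\<^sup>L lebesgue (\<psi> n)) \<longlonglongrightarrow> integral\<^sup>L lebesgue (\<lambda>z :: (real^'n) \<times> real. 0 :: real)"
  proof (rule integral_dominated_convergence[where w = f])
    show "AE z in lebesgue. (\<lambda>n. \<psi> n z) \<longlonglongrightarrow> 0"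
    proof (rule AE_I2)
      fix z :: "(real^'n) \<times> real"
      obtain n0 :: nat where n0: "snd z / \<delta> < real n0" using reals_Archimedean2 by blast
      have "\<psi> n z = 0" if "n0 \<le> n" for n
      proof -
        have "snd z / \<delta> < real (Suc n)" using n0 that by simp
        then show ?thesis using par by (simp add: \<psi>_def field_simps)
      qed
      then show "(\<lambda>n. \<psi> n z) \<longlonglongrightarrow> 0"
        by (intro tendsto_eventually) (auto simp: eventually_sequentially)
    qed
    show "AE z in lebesgue. norm (\<psi> n z) \<le> f z" for n
      using f0 by (auto simp: \<psi>_def indicator_def)
  qed (use f_int \<psi>_int in auto)
  then have \<psi>_lim: "(\<lambda>n. (1 + B) * (1 + M) * integral\<^sup>L lebesgue (\<psi> n)) \<longlonglongrightarrow> 0"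
    using tendsto_mult_right_zero by fastforce
  \<comment> \<open>The test functions are bounded uniformly in \<open>T\<close>, so
    \<open>Y\<close> is controlled by a tail of the fixed integrable function
    \<open>f\<close>.\<close>
  have Y_le: "Y (real (Suc n)) \<le> (1 + B) * (1 + M) * integral\<^sup>L lebesgue (\<psi> n)" for n
  proof -
    let ?T = "real (Suc n)"
    have "Y ?T \<le> integral\<^sup>L lebesgue (\<lambda>z. (1 + B) * (1 + M) * \<psi> n z)"
      unfolding Y_def set_lebesgue_integral_def
    proof (rule integral_mono)
      show "integrable lebesgue (\<lambda>z. indicator (Omega ?T \<inter> {z. \<delta> * ?T \<le> snd z}) z *\<^sub>R h ?T z)"
        using hA_int[of ?T] by (simp add: set_integrable_def)
      show "integrable lebesgue (\<lambda>z. (1 + B) * (1 + M) * \<psi> n z)"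
        using \<psi>_int by simp
      fix z :: "(real^'n) \<times> real"
      show "indicator (Omega ?T \<inter> {z. \<delta> * ?T \<le> snd z}) z *\<^sub>R h ?T z \<le> (1 + B) * (1 + M) * \<psi> n z"
      proof (cases "z \<in> Omega ?T \<inter> {z. \<delta> * ?T \<le> snd z}")
        case True
        then have "z \<in> Omega_inf" by (auto simp: Omega_def Omega_inf_def)
        then have "\<psi> n z = w z" using True by (simp add: \<psi>_def f_def)
        moreover have "w z * \<phi> ?T z \<le> w z * ((1 + B) * (1 + M))"
          using True w0 by (intro mult_left_mono \<phi>) auto
        ultimately show ?thesis using True by (simp add: h_def mult.commute)
      next
        case False
        then show ?thesis using f0 par by (simp add: \<psi>_def)
      qed
    qed
    then show ?thesis by simp
  qed
  have small: "\<forall>\<^sub>F n in sequentially. X (real (Suc n)) \<le> \<epsilon>" if \<epsilon>: "0 < \<epsilon>" for \<epsilon>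
  proof -
    \<comment> \<open>This \<open>K\<close> makes the constant term of the energy inequality exactly
      \<open>\<epsilon> / 2\<close>; the decay of \<open>Y\<close> makes the other term at most
      \<open>\<epsilon> / 2\<close> for large \<open>n\<close>.\<close>
    define K where "K = (\<epsilon> / (2 * C3 * k0)) powr (- (p - 1))"
    have K: "0 < K" using \<epsilon> C3 k0 by (simp add: K_def)
    have "- (p - 1) * - (1 / (p - 1)) = 1" using assms(5) by (simp add: field_simps)
    then have "K powr (- (1 / (p - 1))) = \<epsilon> / (2 * C3 * k0)"
      unfolding K_def powr_powr using \<epsilon> C3 k0 by simp
    then have K1: "C3 * (K powr (- (1 / (p - 1))) * k0) = \<epsilon> / 2"
      using C3 k0 by simp
    have "\<forall>\<^sub>F n in sequentially. (1 + B) * (1 + M) * integral\<^sup>L lebesgue (\<psi> n) < \<epsilon> / (2 * C3 * K)"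
      using \<psi>_lim \<epsilon> C3 K by (intro order_tendstoD) auto
    then show ?thesis
    proof eventually_elim
      case (elim n)
      then have "C3 * K * Y (real (Suc n)) \<le> C3 * K * (\<epsilon> / (2 * C3 * K))"
        using Y_le[of n] C3 K by (intro mult_left_mono) auto
      also have "\<dots> = \<epsilon> / 2" using C3 K by simp
      finally show ?case
        using X_le[of "real (Suc n)" K] K K1 by (simp add: distrib_left mult.assoc)
    qed
  qed
  have "integral\<^sup>L lebesgue f \<le> 0"
  proof (rule field_le_epsilon)
    fix \<epsilon> :: real assume \<epsilon>: "0 < \<epsilon>"
    have "ennreal (integral\<^sup>L lebesgue f) = (\<integral>\<^sup>+z. ennreal (f z) \<partial>lebesgue)"
      using f_int f0 by (intro nn_integral_eq_integral[symmetric]) auto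
    also have "\<dots> \<le> ennreal \<epsilon>" by (rule nn_le[OF small[OF \<epsilon>]])
    finally show "integral\<^sup>L lebesgue f \<le> 0 + \<epsilon>" using \<epsilon> by (simp add: ennreal_le_iff)
  qed
  then have "integral\<^sup>L lebesgue f = 0"
    using f0 by (intro antisym integral_nonneg_AE) auto
  then have "AE z in lebesgue. f z = 0"
    using f_int f0 by (subst (asm) integral_nonneg_eq_0_iff_AE) auto
  \<comment> \<open>For nonzero \<open>x\<close> and positive time the weight is positive, so a
    vanishing source forces \<open>u\<close> to vanish.\<close>
  then show ?thesis
    using assms(9) AE_fst_nonzero
  proof eventually_elim
    case (elim z)
    show ?case
    proof
      assume z: "z \<in> Omega_inf"
      then have "0 < snd z" by (auto simp: Omega_inf_def)
      then show "u z = 0" using elim z by (auto simp: f_def w_def)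
    qed
  qed
qed

end
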